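(* Let $n\ge 1$, let $\lambda$ be a partition with $l(\lambda)\le n$, and let $t,a,b,t_0,t_1,t_2,t_3$ be complex parameters of modulus less than $1$. Then the function $K_\lambda^{(n)}(z;t;a,b;t_0,\dots,t_3)$ (defined in the context) is triangular with respect to the dominance ordering: there are coefficients $c^\lambda_\mu$ such that $$K_{\lambda}^{(n)}(z;t;a,b;t_{0}, \dots, t_{3}) = m_{\lambda} + \sum_{\mu < \lambda} c^{\lambda}_{\mu}\, m_{\mu},$$ where the sum is over partitions $\mu$ with $l(\mu)\le n$ and $\mu<\lambda$.
   Context: A partition $\lambda=(\lambda_1,\dots,\lambda_n)$ with $l(\lambda)\le n$ is a non-increasing string of $n$ non-negative integers (zeros allowed); $l(\lambda)$ is the number of nonzero parts, and $m_i(\lambda)$ is the number of indices $j\in\{1,\dots,n\}$ with $\lambda_j=i$, for $i\ge 0$. Dominance ordering (no condition that the weights agree): $\mu\le\lambda$ if and only if $\sum_{i=1}^k\mu_i\le\sum_{i=1}^k\lambda_i$ for all $1\le k\le n$; $\mu<\lambda$ means $\mu\le\lambda$ and $\mu\ne\lambda$. The hyperoctahedral group $B_n$ consists of pairs (permutation $\rho\in S_n$, signs $\epsilon_\rho(i)\in\{\pm1\}$), acting on functions of $z_1,\dots,z_n$ by $z_i\mapsto z_{\rho(i)}^{\epsilon_\rho(i)}$. For a partition $\mu$ with $l(\mu)\le n$, $m_\mu$ denotes the $BC_n$ monomial symmetric Laurent polynomial: the sum of the distinct monomials in the $B_n$-orbit of $z_1^{\mu_1}\cdots z_n^{\mu_n}$.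 Define $$v_{\lambda}(t;a,b;t_{0}, \dots, t_{3}) = \Bigg( \prod_{i \geq 0} \prod_{j=1}^{m_{i}(\lambda)} \frac{1- t^{j}}{1-t} \Bigg) \prod_{i=1}^{m_{1}(\lambda)} (1- t_{0}t_{1}t_{2}t_{3} t^{i-1+2m_{0}(\lambda)}) \prod_{i=1}^{m_{0}(\lambda)} (1-ab\, t^{i-1}),$$ and $$K_\lambda^{(n)}(z;t;a,b;t_0,\dots,t_3)= \frac{1}{v_{\lambda}(t;a,b;t_{0}, \dots, t_{3})} \sum_{w \in B_{n}} w \Bigg( \prod_{1 \leq i \leq n} u_{\lambda}(z_{i}) \prod_{1 \leq i<j \leq n} \frac{1-tz_{i}^{-1}z_{j}}{1-z_{i}^{-1}z_{j}}\, \frac{1-tz_{i}^{-1}z_{j}^{-1}}{1-z_{i}^{-1}z_{j}^{-1}} \Bigg),$$ where $$u_\lambda(z_i)=\frac{(1-az_i^{-1})(1-bz_i^{-1})}{1-z_i^{-2}}\ \text{ if }\lambda_i=0,\qquad u_\lambda(z_i)=z_i^{\lambda_i}\,\frac{(1-t_0z_i^{-1})(1-t_1z_i^{-1})(1-t_2z_i^{-1})(1-t_3z_i^{-1})}{1-z_i^{-2}}\ \text{ if }\lambda_i>0.$$ *)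

theory Defs
  imports "HOL-Analysis.Analysis" "HOL-Combinatorics.Permutations"
begin

text \<open>
  A partition \<open>(\<lambda>\<^sub>1, \<dots>, \<lambda>\<^sub>n)\<close> is a function on \<open>nat\<close> that is zero outside \<open>{1..n}\<close>, so that
  equality of functions is equality of strings.
\<close>

definition partitions_upto :: "nat \<Rightarrow> (nat \<Rightarrow> nat) set" where
  "partitions_upto n =
     {mu. (\<forall>i\<in>{1..n}. \<forall>j\<in>{1..n}. i \<le> j \<longrightarrow> mu j \<le> mu i) \<and> (\<forall>i. i \<notin> {1..n} \<longrightarrow> mu i = 0)}"

definition mult_part :: "nat \<Rightarrow> (nat \<Rightarrow> nat) \<Rightarrow> nat \<Rightarrow> nat" where
  "mult_part n mu i = card {j \<in> {1..n}. mu j = i}"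

definition dominance_le :: "nat \<Rightarrow> (nat \<Rightarrow> nat) \<Rightarrow> (nat \<Rightarrow> nat) \<Rightarrow> bool" where
  "dominance_le n mu nu \<longleftrightarrow> (\<forall>k\<in>{1..n}. (\<Sum>i=1..k. mu i) \<le> (\<Sum>i=1..k. nu i))"

definition dominance_less :: "nat \<Rightarrow> (nat \<Rightarrow> nat) \<Rightarrow> (nat \<Rightarrow> nat) \<Rightarrow> bool" where
  "dominance_less n mu nu \<longleftrightarrow> dominance_le n mu nu \<and> mu \<noteq> nu"

definition hyperoctahedral :: "nat \<Rightarrow> ((nat \<Rightarrow> nat) \<times> (nat \<Rightarrow> int)) set" where
  "hyperoctahedral n = {\<rho>. \<rho> permutes {1..n}} \<times> ({1..n} \<rightarrow>\<^sub>E {1, -1})"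

definition act_point :: "(nat \<Rightarrow> nat) \<times> (nat \<Rightarrow> int) \<Rightarrow> (nat \<Rightarrow> complex) \<Rightarrow> (nat \<Rightarrow> complex)" where
  "act_point w z = (\<lambda>i. z (fst w i) powi snd w i)"

definition act_fun ::
  "(nat \<Rightarrow> nat) \<times> (nat \<Rightarrow> int) \<Rightarrow> ((nat \<Rightarrow> complex) \<Rightarrow> complex) \<Rightarrow> (nat \<Rightarrow> complex) \<Rightarrow> complex" where
  "act_fun w f = (\<lambda>z. f (act_point w z))"

definition laurent_monom :: "nat \<Rightarrow> (nat \<Rightarrow> int) \<Rightarrow> (nat \<Rightarrow> complex) \<Rightarrow> complex" where
  "laurent_monom n \<alpha> z = (\<Prod>i=1..n. z i powi \<alpha> i)"

text \<open>
  Distinct Laurent monomials correspond to distinct exponent vectors. The exponent vector of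
  \<open>w (z\<^sub>1\<^bsup>\<alpha>\<^sub>1\<^esup> \<cdots> z\<^sub>n\<^bsup>\<alpha>\<^sub>n\<^esup>)\<close> has entry \<open>\<epsilon> i * \<alpha> i\<close> at position \<open>\<rho> i\<close>; see
  \<open>act_fun_laurent_monom\<close> below.
\<close>

definition act_exponent :: "nat \<Rightarrow> (nat \<Rightarrow> nat) \<times> (nat \<Rightarrow> int) \<Rightarrow> (nat \<Rightarrow> int) \<Rightarrow> (nat \<Rightarrow> int)" where
  "act_exponent n w \<alpha> =
     (\<lambda>j. if j \<in> {1..n} then snd w (inv (fst w) j) * \<alpha> (inv (fst w) j) else 0)"

definition monom_sym_BC :: "nat \<Rightarrow> (nat \<Rightarrow> nat) \<Rightarrow> (nat \<Rightarrow> complex) \<Rightarrow> complex" where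
  "monom_sym_BC n mu z =
     (\<Sum>\<alpha> \<in> (\<lambda>w. act_exponent n w (\<lambda>i. int (mu i))) ` hyperoctahedral n. laurent_monom n \<alpha> z)"

text \<open>
  In the first product only the values \<open>i\<close> taken by \<open>lam\<close> occur; for every other \<open>i \<ge> 0\<close> the
  multiplicity is zero and the inner product is empty.
\<close>

definition K_norm ::
  "nat \<Rightarrow> (nat \<Rightarrow> nat) \<Rightarrow> complex \<Rightarrow> complex \<Rightarrow> complex \<Rightarrow>
   complex \<Rightarrow> complex \<Rightarrow> complex \<Rightarrow> complex \<Rightarrow> complex" where
  "K_norm n lam t a b t0 t1 t2 t3 =
     (\<Prod>i \<in> lam ` {1..n}. \<Prod>j=1..mult_part n lam i. (1 - t ^ j) / (1 - t)) *
     (\<Prod>i=1..mult_part n lam 1. 1 - t0 * t1 * t2 * t3 * t ^ (i - 1 + 2 * mult_part n lam 0)) *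
     (\<Prod>i=1..mult_part n lam 0. 1 - a * b * t ^ (i - 1))"

definition K_univ ::
  "nat \<Rightarrow> complex \<Rightarrow> complex \<Rightarrow> complex \<Rightarrow> complex \<Rightarrow> complex \<Rightarrow> complex \<Rightarrow> complex \<Rightarrow> complex" where
  "K_univ l a b t0 t1 t2 t3 x =
     (if l = 0
      then (1 - a * inverse x) * (1 - b * inverse x) / (1 - inverse x ^ 2)
      else x ^ l * ((1 - t0 * inverse x) * (1 - t1 * inverse x) *
                    (1 - t2 * inverse x) * (1 - t3 * inverse x) / (1 - inverse x ^ 2)))"

definition K_summand ::
  "nat \<Rightarrow> (nat \<Rightarrow> nat) \<Rightarrow> complex \<Rightarrow> complex \<Rightarrow> complex \<Rightarrow>
   complex \<Rightarrow> complex \<Rightarrow> complex \<Rightarrow> complex \<Rightarrow> (nat \<Rightarrow> complex) \<Rightarrow> complex" where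
  "K_summand n lam t a b t0 t1 t2 t3 z =
     (\<Prod>i=1..n. K_univ (lam i) a b t0 t1 t2 t3 (z i)) *
     (\<Prod>(i, j) \<in> {(i, j). 1 \<le> i \<and> i < j \<and> j \<le> n}.
        (1 - t * inverse (z i) * z j) / (1 - inverse (z i) * z j) *
        ((1 - t * inverse (z i) * inverse (z j)) / (1 - inverse (z i) * inverse (z j))))"

definition K_poly ::
  "nat \<Rightarrow> (nat \<Rightarrow> nat) \<Rightarrow> complex \<Rightarrow> complex \<Rightarrow> complex \<Rightarrow>
   complex \<Rightarrow> complex \<Rightarrow> complex \<Rightarrow> complex \<Rightarrow> (nat \<Rightarrow> complex) \<Rightarrow> complex" where
  "K_poly n lam t a b t0 t1 t2 t3 z =
     1 / K_norm n lam t a b t0 t1 t2 t3 *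
     (\<Sum>w \<in> hyperoctahedral n. act_fun w (K_summand n lam t a b t0 t1 t2 t3) z)"

text \<open>
  The points at which no denominator of any of the \<open>2\<^sup>n n!\<close> summands vanishes. An identity of
  rational functions is an identity of values at all these points. Outside this set, the convention
  \<open>x / 0 = 0\<close> would make \<open>K_poly\<close> differ from the rational function.
\<close>

definition generic_points :: "nat \<Rightarrow> (nat \<Rightarrow> complex) set" where
  "generic_points n =
     {z. (\<forall>i\<in>{1..n}. z i \<noteq> 0 \<and> z i ^ 2 \<noteq> 1) \<and>
         (\<forall>i\<in>{1..n}. \<forall>j\<in>{1..n}. i \<noteq> j \<longrightarrow> z i \<noteq> z j \<and> z i * z j \<noteq> 1)}"

lemma act_fun_laurent_monom:
  assumes w: "w \<in> hyperoctahedral n"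
  shows "act_fun w (laurent_monom n \<alpha>) = laurent_monom n (act_exponent n w \<alpha>)"
proof
  fix z :: "nat \<Rightarrow> complex"
  have p: "fst w permutes {1..n}"
    using w by (auto simp: hyperoctahedral_def)
  have "laurent_monom n (act_exponent n w \<alpha>) z =
          (\<Prod>j\<in>{1..n}. z j powi (snd w (inv (fst w) j) * \<alpha> (inv (fst w) j)))"
    unfolding laurent_monom_def act_exponent_def by (intro prod.cong) auto
  also have "\<dots> = (\<Prod>i\<in>{1..n}. z (fst w i) powi (snd w i * \<alpha> i))"
    using prod.permute[OF p, of "\<lambda>j. z j powi (snd w (inv (fst w) j) * \<alpha> (inv (fst w) j))"]
    by (simp add: o_def permutes_inverses[OF p])
  also have "\<dots> = act_fun w (laurent_monom n \<alpha>) z"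
    unfolding act_fun_def act_point_def laurent_monom_def by (simp add: power_int_mult)
  finally show "act_fun w (laurent_monom n \<alpha>) z = laurent_monom n (act_exponent n w \<alpha>) z" ..
qed

lemma finite_hyperoctahedral: "finite (hyperoctahedral n)"
  unfolding hyperoctahedral_def
  by (intro finite_cartesian_product finite_permutations finite_PiE) auto

lemma finite_dominated: "finite {mu \<in> partitions_upto n. dominance_less n mu lam}"
proof (rule finite_subset)
  show "{mu \<in> partitions_upto n. dominance_less n mu lam} \<subseteq>
          {f. \<forall>i. (i \<in> {1..n} \<longrightarrow> f i \<in> {..lam 1}) \<and> (i \<notin> {1..n} \<longrightarrow> f i = 0)}"
  proof safe
    fix mu i
    assume mu: "mu \<in> partitions_upto n" "dominance_less n mu lam" and i: "i \<in> {1..n}"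
    have "mu i \<le> mu 1"
      using mu(1) i by (auto simp: partitions_upto_def)
    also have "mu 1 \<le> lam 1"
      using mu(2) i unfolding dominance_less_def dominance_le_def by (force dest: bspec[of _ _ 1])
    finally show "mu i \<le> lam 1" .
  qed (auto simp: partitions_upto_def)
  show "finite {f. \<forall>i. (i \<in> {1..n} \<longrightarrow> f i \<in> {..lam 1}) \<and> (i \<notin> {1..n} \<longrightarrow> f i = (0::nat))}"
    by (rule finite_set_of_finite_funs) auto
qed

end

theory Submission
  imports Defs "HOL-Computational_Algebra.Polynomial" "HOL-Combinatorics.Multiset_Permutations"
begin

text \<open>
  The proof separates two questions: why the sum over the hyperoctahedral group is a Laurent
  polynomial at all, and which of its coefficients survive.

  The substitution \<open>x\<^sub>i = z\<^sub>i + 1/z\<^sub>i\<close> turns type \<open>BC\<close> into type \<open>A\<close>. The two factors belonging to a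
  pair \<open>i < j\<close> combine to
  \<open>(z\<^sub>i - t x\<^sub>j + t\<^sup>2/z\<^sub>i) / (x\<^sub>i - x\<^sub>j)\<close>, which does not change under \<open>z\<^sub>j \<mapsto> 1/z\<^sub>j\<close>. Hence the sum over
  the sign of \<open>z\<^sub>i\<close> can be carried out separately for each \<open>i\<close>; the denominator \<open>z\<^sub>i - 1/z\<^sub>i\<close> cancels
  and a polynomial in \<open>x\<^sub>i\<close> remains over \<open>\<Prod>(x\<^sub>i - x\<^sub>j)\<close>. What is left is a sum over permutations that
  can be evaluated recursively: choose which variable stands first, and the remaining variables give
  the same kind of sum with one part fewer (\<open>peel_sum\<close>). Each step is a sum
  \<open>\<Sum>\<^sub>y h(y) / \<Prod>(y - x)\<close> over the set of all \<open>x\<^sub>i\<close>, where \<open>h\<close> is a polynomial in \<open>y\<close> with symmetric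
  coefficients. Such a Lagrange sum is again a symmetric polynomial (\<open>lagrange_sum_symfun\<close>), so
  the whole sum is a polynomial in the \<open>x\<^sub>i\<close> that depends only on the set of their values
  (\<open>peel_sum_symfun\<close>). It is therefore a Laurent polynomial invariant under the hyperoctahedral group,
  and averaging over the group writes it as a finite combination of the \<open>m\<^sub>\<mu>\<close>
  (\<open>symfun_monom_expansion\<close>).

  The coefficients are controlled by growth rates. Put \<open>z\<^sub>i = r\<^bsup>-M\<^sub>i\<^esup>\<close> with integers
  \<open>M\<^sub>1 > \<dots> > M\<^sub>n > 0\<close> and let \<open>r\<close> tend to \<open>0\<close>. Each factor of each summand has a limit after
  rescaling, and the recursion shows that the sum is asymptotic to \<open>v r\<^bsup>-\<langle>M,\<lambda>\<rangle>\<^esup>\<close>, where \<open>v\<close> is a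
  product of factors \<open>(1 + t + \<dots> + t\<^bsup>m-1\<^esup>)(1 - e t\<^bsup>k\<^esup>)\<close>, one for each part
  (\<open>peel_sum_limit\<close>). This product is the normalising factor \<open>v\<^sub>\<lambda>\<close> (\<open>K_norm_eq_lead_coef\<close>), and
  it is nonzero because all parameters have modulus less than \<open>1\<close>. On the other hand \<open>m\<^sub>\<mu>\<close> is
  asymptotic to \<open>r\<^bsup>-\<langle>M,\<mu>\<rangle>\<^esup>\<close>. If \<open>M\<close> gives different weights to all \<open>\<mu>\<close> that occur, no cancellation
  between leading terms is possible, so \<open>\<langle>M,\<mu>\<rangle> \<le> \<langle>M,\<lambda>\<rangle>\<close> for all of them, with equality only for
  \<open>\<mu> = \<lambda>\<close>, whose coefficient is \<open>v\<^sub>\<lambda>\<close>. Weights that are very large on \<open>{1..k}\<close> extract the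
  inequality between the \<open>k\<close>-th partial sums (\<open>dominance_of_growth\<close>).
\<close>

section \<open>Symmetric functions of a finite set of complex numbers\<close>

text \<open>
  For a set of \<open>m \<ge> 1\<close> numbers this is the complete homogeneous symmetric polynomial of degree
  \<open>d - (m - 1)\<close>, and \<open>0\<close> when that degree is negative.
\<close>

definition divided_power :: "nat \<Rightarrow> complex set \<Rightarrow> complex" where
  "divided_power d X = (\<Sum>y\<in>X. y ^ d / (\<Prod>x\<in>X - {y}. y - x))"

text \<open>
  Up to the sign \<open>(-1)\<^sup>r\<close> this is the elementary symmetric polynomial of degree \<open>r\<close>.
\<close>

definition elem_coeff :: "nat \<Rightarrow> complex set \<Rightarrow> complex" where
  "elem_coeff r X = coeff (\<Prod>x\<in>X. [:1, - x:]) r"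

text \<open>
  A symmetric polynomial is represented as a function of the finite \<^emph>\<open>set\<close> of its arguments, which makes
  symmetry automatic and lets the same function be evaluated on sets of different sizes. The congruence
  rule allows arbitrary values on infinite sets.
\<close>

inductive_set symfun :: "(complex set \<Rightarrow> complex) set" where
  symfun_const: "(\<lambda>X. c) \<in> symfun"
| symfun_elem: "elem_coeff r \<in> symfun"
| symfun_div: "divided_power d \<in> symfun"
| symfun_add: "f \<in> symfun \<Longrightarrow> g \<in> symfun \<Longrightarrow> (\<lambda>X. f X + g X) \<in> symfun"
| symfun_mult: "f \<in> symfun \<Longrightarrow> g \<in> symfun \<Longrightarrow> (\<lambda>X. f X * g X) \<in> symfun"
| symfun_cong: "f \<in> symfun \<Longrightarrow> (\<And>X. finite X \<Longrightarrow> g X = f X) \<Longrightarrow> g \<in> symfun"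

text \<open>
  Polynomials in one further variable \<open>y\<close> with symmetric coefficients; values matter only for \<open>y\<close>
  in the set.
\<close>

inductive_set symfun_ext :: "(complex set \<Rightarrow> complex \<Rightarrow> complex) set" where
  ext_monom: "f \<in> symfun \<Longrightarrow> (\<lambda>X y. f X * y ^ d) \<in> symfun_ext"
| ext_add: "f \<in> symfun_ext \<Longrightarrow> g \<in> symfun_ext \<Longrightarrow> (\<lambda>X y. f X y + g X y) \<in> symfun_ext"
| ext_cong: "f \<in> symfun_ext \<Longrightarrow> (\<And>X y. finite X \<Longrightarrow> y \<in> X \<Longrightarrow> g X y = f X y) \<Longrightarrow> g \<in> symfun_ext"

lemma ext_symfun: "f \<in> symfun \<Longrightarrow> (\<lambda>X y. f X) \<in> symfun_ext"
  using ext_monom[of f 0] by simp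

lemma ext_const: "(\<lambda>X y. c) \<in> symfun_ext"
  by (rule ext_symfun) (rule symfun_const)

lemma ext_var: "(\<lambda>X y. y) \<in> symfun_ext"
  using ext_monom[OF symfun_const[of 1], of 1] by simp

lemma ext_mult:
  assumes "f \<in> symfun_ext" "g \<in> symfun_ext"
  shows "(\<lambda>X y. f X y * g X y) \<in> symfun_ext"
  using assms(1)
proof induction
  case (ext_monom f d)
  show ?case using assms(2)
  proof induction
    case (ext_monom g e)
    from symfun_ext.ext_monom[OF symfun_mult[OF \<open>f \<in> symfun\<close> \<open>g \<in> symfun\<close>], of "d + e"]
    show ?case by (simp add: power_add mult_ac)
  next
    case (ext_add g h)
    from symfun_ext.ext_add[OF ext_add.IH] show ?case by (simp add: distrib_left)
  next
    case (ext_cong g h)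
    from \<open>(\<lambda>X y. f X * y ^ d * g X y) \<in> symfun_ext\<close> show ?case
      by (rule symfun_ext.ext_cong) (simp add: ext_cong.hyps)
  qed
next
  case (ext_add f h)
  from symfun_ext.ext_add[OF ext_add.IH] show ?case by (simp add: distrib_right)
next
  case (ext_cong f h)
  from \<open>(\<lambda>X y. f X y * g X y) \<in> symfun_ext\<close> show ?case
    by (rule symfun_ext.ext_cong) (simp add: ext_cong.hyps)
qed

lemma ext_diff:
  assumes "f \<in> symfun_ext" "g \<in> symfun_ext"
  shows "(\<lambda>X y. f X y - g X y) \<in> symfun_ext"
  using ext_add[OF assms(1) ext_mult[OF ext_const[of "-1"] assms(2)]] by simp

lemma ext_sum:
  assumes "\<And>i. i \<in> A \<Longrightarrow> f i \<in> symfun_ext"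
  shows "(\<lambda>X y. \<Sum>i\<in>A. f i X y) \<in> symfun_ext"
  using assms
proof (induction A rule: infinite_finite_induct)
  case (insert i A)
  then show ?case by (simp add: ext_add)
qed (simp_all add: ext_const)

lemma ext_poly: "(\<lambda>X y. poly p y) \<in> symfun_ext"
  by (induction p) (auto intro!: ext_const ext_add ext_mult ext_var)

lemma elem_coeff_remove:
  assumes "finite X" "y \<in> X"
  shows "elem_coeff 0 (X - {y}) = 1"
    and "elem_coeff (Suc r) (X - {y}) = elem_coeff (Suc r) X + y * elem_coeff r (X - {y})"
proof -
  show "elem_coeff 0 (X - {y}) = 1"
    by (simp add: elem_coeff_def poly_0_coeff_0[symmetric] poly_prod)
  have "(\<Prod>x\<in>X. [:1, - x:]) = [:1, -y:] * (\<Prod>x\<in>X - {y}. [:1, - x:])"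
    using assms by (rule prod.remove)
  then show "elem_coeff (Suc r) (X - {y}) = elem_coeff (Suc r) X + y * elem_coeff r (X - {y})"
    by (simp add: elem_coeff_def coeff_pCons)
qed

text \<open>
  Multiplying a summand by \<open>u - y\<close> kills the term \<open>u = y\<close> and cancels one factor of every other
  denominator.
\<close>

lemma divided_power_remove:
  assumes "finite X" "y \<in> X"
  shows "divided_power d (X - {y}) = divided_power (Suc d) X - y * divided_power d X"
proof -
  have "divided_power (Suc d) X - y * divided_power d X =
          (\<Sum>u\<in>X. u ^ d * (u - y) / (\<Prod>x\<in>X - {u}. u - x))"
    unfolding divided_power_def sum_distrib_left sum_subtractf[symmetric]
    by (intro sum.cong refl) (simp add: algebra_simps diff_divide_distrib)
  also have "\<dots> = (\<Sum>u\<in>X - {y}. u ^ d * (u - y) / (\<Prod>x\<in>X - {u}. u - x))"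
    using assms by (subst sum.remove[of X y]) auto
  also have "\<dots> = divided_power d (X - {y})"
    unfolding divided_power_def
  proof (intro sum.cong refl)
    fix u assume u: "u \<in> X - {y}"
    have "(\<Prod>x\<in>X - {u}. u - x) = (u - y) * (\<Prod>x\<in>X - {u} - {y}. u - x)"
      using assms u by (intro prod.remove) auto
    moreover have "X - {u} - {y} = X - {y} - {u}" by auto
    ultimately show "u ^ d * (u - y) / (\<Prod>x\<in>X - {u}. u - x) = u ^ d / (\<Prod>x\<in>X - {y} - {u}. u - x)"
      using u by simp
  qed
  finally show ?thesis ..
qed

text \<open>
  A symmetric function of the set without \<open>y\<close> is a polynomial in \<open>y\<close> whose coefficients are symmetric
  in the whole set: for both families of generators, the recursions above express the value at the
  smaller set in this form.
\<close>

lemma symfun_remove_in_ext: "f \<in> symfun \<Longrightarrow> (\<lambda>X y. f (X - {y})) \<in> symfun_ext"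
proof (induction rule: symfun.induct)
  case (symfun_const c)
  show ?case by (rule ext_const)
next
  case (symfun_elem r)
  show ?case
  proof (induction r)
    case 0
    show ?case by (rule ext_cong[OF ext_const[of 1]]) (simp add: elem_coeff_remove)
  next
    case (Suc r)
    show ?case
      by (rule ext_cong[OF ext_add[OF ext_symfun[OF symfun.symfun_elem[of "Suc r"]] ext_mult[OF ext_var Suc]]])
         (simp add: elem_coeff_remove)
  qed
next
  case (symfun_div d)
  show ?case
    by (rule ext_cong[OF ext_diff[OF ext_symfun[OF symfun.symfun_div[of "Suc d"]]
            ext_mult[OF ext_var ext_symfun[OF symfun.symfun_div[of d]]]]])
       (simp add: divided_power_remove)
next
  case (symfun_add f g)
  then show ?case by (intro ext_add)
next
  case (symfun_mult f g)
  then show ?case by (intro ext_mult)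
next
  case (symfun_cong f g)
  show ?case by (rule ext_cong[OF symfun_cong.IH]) (simp add: symfun_cong.hyps)
qed

text \<open>
  By linearity it suffices to take \<open>h\<close> to be a symmetric function times \<open>y\<^sup>d\<close>; the
  symmetric factor comes out of the sum and leaves a generator.
\<close>

lemma lagrange_sum_symfun:
  assumes "h \<in> symfun_ext"
  shows "(\<lambda>X. \<Sum>y\<in>X. h X y / (\<Prod>x\<in>X - {y}. y - x)) \<in> symfun"
  using assms
proof induction
  case (ext_monom f d)
  from symfun_mult[OF ext_monom symfun_div[of d]]
  show ?case by (simp add: divided_power_def sum_distrib_left)
next
  case (ext_add f g)
  from symfun_add[OF ext_add.IH] show ?case by (simp add: add_divide_distrib sum.distrib)
next
  case (ext_cong f g)
  show ?case by (rule symfun_cong[OF ext_cong.IH]) (auto intro!: sum.cong simp: ext_cong.hyps)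
qed

text \<open>
  The Laurent polynomials in \<open>z\<close> form a free module with basis \<open>1, z\<close> over the polynomials in
  \<open>z + 1/z\<close>, because \<open>z\<^sup>2 = (z + 1/z) z - 1\<close>. This normal form makes antisymmetrisation under
  \<open>z \<mapsto> 1/z\<close> a matter of reading off the coefficient of \<open>z\<close>.
\<close>

definition quad_form :: "(complex \<Rightarrow> complex) \<Rightarrow> bool" where
  "quad_form g \<longleftrightarrow> (\<exists>P Q. \<forall>z. z \<noteq> 0 \<longrightarrow>
     g z = poly P (z + inverse z) + z * poly Q (z + inverse z))"

lemma quad_formI:
  assumes "\<And>z. z \<noteq> 0 \<Longrightarrow> g z = poly P (z + inverse z) + z * poly Q (z + inverse z)"
  shows "quad_form g"
  using assms unfolding quad_form_def by blast

lemma quad_form_const: "quad_form (\<lambda>z. c)"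
  by (rule quad_formI[of _ "[:c:]" 0]) simp

lemma quad_form_ident: "quad_form (\<lambda>z. z)"
  by (rule quad_formI[of _ 0 1]) simp

lemma quad_form_inverse: "quad_form (\<lambda>z. inverse z)"
  by (rule quad_formI[of _ "[:0, 1:]" "-1"]) simp

lemma quad_form_add: "quad_form f \<Longrightarrow> quad_form g \<Longrightarrow> quad_form (\<lambda>z. f z + g z)"
  unfolding quad_form_def
  apply (elim exE)
  subgoal for P P' Q Q' by (rule exI[of _ "P + P'"], rule exI[of _ "Q + Q'"]) (simp add: algebra_simps)
  done

lemma quad_form_mult: 
  assumes "quad_form f" "quad_form g"
  shows "quad_form (\<lambda>z. f z * g z)"
proof -
  obtain P Q where f: "\<And>z. z \<noteq> 0 \<Longrightarrow> f z = poly P (z + inverse z) + z * poly Q (z + inverse z)"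
    using assms(1) unfolding quad_form_def by blast
  obtain P' Q' where g: "\<And>z. z \<noteq> 0 \<Longrightarrow> g z = poly P' (z + inverse z) + z * poly Q' (z + inverse z)"
    using assms(2) unfolding quad_form_def by blast
  show ?thesis
  proof (rule quad_formI[of _ "P * P' - Q * Q'" "P * Q' + P' * Q + [:0, 1:] * (Q * Q')"])
    fix z :: complex assume z: "z \<noteq> 0"
    define x where "x = z + inverse z"
    have zz: "z * z = x * z - 1" using z by (simp add: x_def field_simps)
    have expand: "(p + z * q) * (p' + z * q') = p * p' + z * (p * q' + p' * q) + (z * z) * (q * q')"
      for p q p' q' :: complex
      by (simp add: algebra_simps)
    have "(p + z * q) * (p' + z * q') = p * p' - q * q' + z * (p * q' + p' * q + x * (q * q'))"
      for p q p' q' :: complex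
      unfolding expand zz by (simp add: algebra_simps)
    thus "f z * g z = poly (P * P' - Q * Q') (z + inverse z) +
            z * poly (P * Q' + P' * Q + [:0, 1:] * (Q * Q')) (z + inverse z)"
      using z by (simp add: f g x_def)
  qed
qed

lemma quad_form_power: "quad_form f \<Longrightarrow> quad_form (\<lambda>z. f z ^ k)"
  by (induction k) (auto intro: quad_form_const quad_form_mult)

lemma quad_form_diff: "quad_form f \<Longrightarrow> quad_form g \<Longrightarrow> quad_form (\<lambda>z. f z - g z)"
  using quad_form_add[OF _ quad_form_mult[OF quad_form_const[of "-1"]]] by fastforce

lemmas quad_form_intros = quad_form_const quad_form_ident quad_form_inverse quad_form_add
  quad_form_mult quad_form_power quad_form_diff

lemma quad_form_antisym:
  assumes "quad_form g"
  shows "\<exists>Q. \<forall>z. z \<noteq> 0 \<longrightarrow> z\<^sup>2 \<noteq> 1 \<longrightarrow>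
    (g z - g (inverse z)) / (z - inverse z) = poly Q (z + inverse z)"
proof -
  obtain P Q where g: "\<And>z. z \<noteq> 0 \<Longrightarrow> g z = poly P (z + inverse z) + z * poly Q (z + inverse z)"
    using assms unfolding quad_form_def by blast
  have "(g z - g (inverse z)) / (z - inverse z) = poly Q (z + inverse z)" if z: "z \<noteq> 0" "z\<^sup>2 \<noteq> 1" for z
  proof -
    have "z - inverse z \<noteq> 0" using z by (auto simp: field_simps power2_eq_square)
    moreover have "g z - g (inverse z) = (z - inverse z) * poly Q (z + inverse z)"
      using z by (simp add: g algebra_simps)
    ultimately show ?thesis by simp
  qed
  thus ?thesis by blast
qed

section \<open>Peeling off one variable at a time\<close>

text \<open>
  The Joukowski coordinate of \<open>z\<^sub>i\<close>, invariant under inversion.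
\<close>

definition jouk :: "(nat \<Rightarrow> complex) \<Rightarrow> nat \<Rightarrow> complex" where
  "jouk z i = z i + inverse (z i)"

definition generic_on :: "nat set \<Rightarrow> (nat \<Rightarrow> complex) \<Rightarrow> bool" where
  "generic_on S z \<longleftrightarrow> (\<forall>i\<in>S. z i \<noteq> 0 \<and> z i ^ 2 \<noteq> 1) \<and>
     (\<forall>i\<in>S. \<forall>j\<in>S. i \<noteq> j \<longrightarrow> z i \<noteq> z j \<and> z i * z j \<noteq> 1)"

lemma generic_on_subset: "generic_on S z \<Longrightarrow> T \<subseteq> S \<Longrightarrow> generic_on T z"
  unfolding generic_on_def by blast

lemma generic_points_iff: "z \<in> generic_points n \<longleftrightarrow> generic_on {1..n} z"
  unfolding generic_points_def generic_on_def by simp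

lemma jouk_inj:
  assumes "generic_on S z"
  shows "inj_on (jouk z) S"
proof (rule inj_onI, rule ccontr)
  fix i j assume *: "i \<in> S" "j \<in> S" "jouk z i = jouk z j" "i \<noteq> j"
  have nz: "z i \<noteq> 0" "z j \<noteq> 0" "z i \<noteq> z j" "z i * z j \<noteq> 1"
    using assms * unfolding generic_on_def by auto
  have "(z i - z j) * (z i * z j - 1) = (jouk z i - jouk z j) * (z i * z j)"
    using nz by (simp add: jouk_def field_simps)
  thus False using nz * by simp
qed

text \<open>
  The homogenised form of the generating polynomial of the elementary symmetric functions. It holds
  without dividing by \<open>A\<close> or \<open>t\<close>, either of which may vanish.
\<close>

lemma prod_linear_elem_coeff:
  assumes "finite X"
  shows "(\<Prod>x\<in>X. A - t * x) = (\<Sum>r\<le>card X. elem_coeff r X * t ^ r * A ^ (card X - r))"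
  using assms
proof (induction X)
  case empty
  show ?case by (simp add: elem_coeff_def)
next
  case (insert x X)
  let ?n = "card X" and ?E = "\<lambda>r. elem_coeff r X"
  let ?s = "\<Sum>r\<le>?n. ?E r * t ^ r * A ^ (?n - r)"
  have ins: "(\<Prod>u\<in>insert x X. [:1, - u:]) = [:1, - x:] * (\<Prod>u\<in>X. [:1, - u:])"
    using insert.hyps by simp
  have E0: "elem_coeff 0 (insert x X) = ?E 0"
    and ES: "elem_coeff (Suc r) (insert x X) = ?E (Suc r) - x * ?E r" for r
    unfolding elem_coeff_def ins by (simp_all add: coeff_pCons)
  have "degree (\<Prod>u\<in>X. [:1, - u:]) \<le> (\<Sum>u\<in>X. degree [:1, - u:])"
    using degree_prod_sum_le[OF insert.hyps(1), of "\<lambda>u. [:1, - u:]"] by (simp add: o_def)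
  also have "\<dots> \<le> (\<Sum>u\<in>X. 1)" by (intro sum_mono) auto
  finally have "?E (Suc ?n) = 0" unfolding elem_coeff_def by (intro coeff_eq_0) simp
  have "(\<Sum>r\<le>Suc ?n. elem_coeff r (insert x X) * t ^ r * A ^ (Suc ?n - r)) =
          ?E 0 * A ^ Suc ?n + (\<Sum>r\<le>?n. (?E (Suc r) - x * ?E r) * t ^ Suc r * A ^ (?n - r))"
    by (subst sum.atMost_Suc_shift) (simp add: E0 ES)
  also have "\<dots> = (?E 0 * A ^ Suc ?n + (\<Sum>r\<le>?n. ?E (Suc r) * t ^ Suc r * A ^ (Suc ?n - Suc r)))
                  - t * x * ?s"
    by (simp add: sum_distrib_left left_diff_distrib sum_subtractf mult_ac right_diff_distrib)
  also have "?E 0 * A ^ Suc ?n + (\<Sum>r\<le>?n. ?E (Suc r) * t ^ Suc r * A ^ (Suc ?n - Suc r)) =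
               (\<Sum>r\<le>Suc ?n. ?E r * t ^ r * A ^ (Suc ?n - r))"
    by (subst sum.atMost_Suc_shift) simp
  also have "\<dots> = (\<Sum>r\<le>?n. ?E r * t ^ r * A ^ (Suc ?n - r))"
    using \<open>?E (Suc ?n) = 0\<close> by simp
  also have "\<dots> = A * ?s"
    unfolding sum_distrib_left by (intro sum.cong) (auto simp: Suc_diff_le)
  finally show ?case using insert by (simp add: left_diff_distrib)
qed

locale koornwinder =
  fixes t a b t0 t1 t2 t3 :: complex
begin

definition pair_factor :: "complex \<Rightarrow> complex \<Rightarrow> complex" where
  "pair_factor x y = (1 - t * inverse x * y) / (1 - inverse x * y) *
     ((1 - t * inverse x * inverse y) / (1 - inverse x * inverse y))"

text \<open>
  The contribution of the variable \<open>z\<^sub>k\<close> when it carries a part \<open>l\<close> and the variables indexed by \<open>R\<close>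
  come after it, already summed over the sign of its exponent.
\<close>

definition sign_sum :: "nat \<Rightarrow> nat \<Rightarrow> nat set \<Rightarrow> (nat \<Rightarrow> complex) \<Rightarrow> complex" where
  "sign_sum l k R z = (\<Sum>e\<in>{1, -1::int}. K_univ l a b t0 t1 t2 t3 (z k powi e) *
     (\<Prod>j\<in>R. pair_factor (z k powi e) (z j)))"

primrec peel_sum :: "nat list \<Rightarrow> nat set \<Rightarrow> (nat \<Rightarrow> complex) \<Rightarrow> complex" where
  "peel_sum [] S z = 1"
| "peel_sum (l # ls) S z = (\<Sum>k\<in>S. sign_sum l k (S - {k}) z * peel_sum ls (S - {k}) z)"

text \<open>
  The Laurent polynomial that remains of \<open>K_univ\<close> after the denominator has been brought to the form
  \<open>x - 1/x\<close>, which is odd under inversion.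
\<close>

definition K_numer :: "nat \<Rightarrow> complex \<Rightarrow> complex" where
  "K_numer l x =
     (if l = 0 then x * ((1 - a * inverse x) * (1 - b * inverse x))
      else x * (x ^ l * ((1 - t0 * inverse x) * (1 - t1 * inverse x) *
                    (1 - t2 * inverse x) * (1 - t3 * inverse x))))"

lemma quad_form_K_numer: "quad_form (K_numer l)"
proof (cases "l = 0")
  case True
  then have "K_numer l = (\<lambda>x. x * ((1 - a * inverse x) * (1 - b * inverse x)))"
    by (simp add: K_numer_def fun_eq_iff)
  then show ?thesis by (auto intro!: quad_form_intros)
next
  case False
  then have "K_numer l = (\<lambda>x. x * (x ^ l * ((1 - t0 * inverse x) * (1 - t1 * inverse x) *
                    (1 - t2 * inverse x) * (1 - t3 * inverse x))))"
    by (simp add: K_numer_def fun_eq_iff)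
  then show ?thesis by (auto intro!: quad_form_intros)
qed

lemma K_univ_eq_numer:
  assumes "x \<noteq> 0" "x\<^sup>2 \<noteq> 1"
  shows "K_univ l a b t0 t1 t2 t3 x = K_numer l x / (x - inverse x)"
proof -
  have "1 - inverse x ^ 2 = (x - inverse x) / x"
    using assms by (simp add: field_simps power2_eq_square)
  thus ?thesis by (simp add: K_univ_def K_numer_def mult_ac)
qed

text \<open>
  Both numerator and denominator depend on \<open>y\<close> only through \<open>y + 1/y\<close>, and the denominator depends on
  \<open>x\<close> only through \<open>x + 1/x\<close>.
\<close>

lemma pair_factor_eq:
  assumes "x \<noteq> 0" "y \<noteq> 0" "x \<noteq> y" "x * y \<noteq> 1"
  shows "pair_factor x y = ((x + t\<^sup>2 * inverse x) - t * (y + inverse y)) /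
           ((x + inverse x) - (y + inverse y))"
proof -
  have num: "(1 - t * inverse x * y) * (1 - t * inverse x * inverse y) =
      ((x + t\<^sup>2 * inverse x) - t * (y + inverse y)) / x"
    using assms by (simp add: field_simps power2_eq_square)
  have den: "(1 - inverse x * y) * (1 - inverse x * inverse y) =
      ((x + inverse x) - (y + inverse y)) / x"
    using assms by (simp add: field_simps power2_eq_square)
  have "pair_factor x y = ((1 - t * inverse x * y) * (1 - t * inverse x * inverse y)) /
         ((1 - inverse x * y) * (1 - inverse x * inverse y))"
    by (simp add: pair_factor_def)
  also have "\<dots> = ((x + t\<^sup>2 * inverse x) - t * (y + inverse y)) /
           ((x + inverse x) - (y + inverse y))"
    unfolding num den using assms by simp
  finally show ?thesis .
qed

text \<open>
  The denominators \<open>x\<^sub>k - x\<^sub>j\<close> are the same for both signs. Expanding the product of the numerators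
  in elementary symmetric functions of the remaining \<open>x\<^sub>j\<close>, every coefficient becomes an
  antisymmetrised Laurent polynomial divided by \<open>z\<^sub>k - 1/z\<^sub>k\<close>, that is, a polynomial in \<open>x\<^sub>k\<close>.
  The function \<open>h\<close> may depend on the number of variables but not on \<open>k\<close> or \<open>z\<close>, as the summation
  over \<open>k\<close> requires.
\<close>

lemma sign_sum_in_ext:
  "\<exists>h\<in>symfun_ext. \<forall>S z k. generic_on S z \<longrightarrow> finite S \<longrightarrow> card S = Suc m \<longrightarrow> k \<in> S \<longrightarrow>
     sign_sum l k (S - {k}) z =
       h (jouk z ` S) (jouk z k) / (\<Prod>x\<in>jouk z ` S - {jouk z k}. jouk z k - x)"
proof -
  \<comment> \<open>The coefficient of the \<open>r\<close>-th elementary symmetric function before antisymmetrisation.\<close>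
  define g where "g r x = K_numer l x * (x + t\<^sup>2 * inverse x) ^ (m - r)" for r x
  have "quad_form (\<lambda>x. K_numer l x * (x + t\<^sup>2 * inverse x) ^ (m - r))" for r
    by (intro quad_form_intros quad_form_K_numer)
  then have "quad_form (g r)" for r
    by (simp add: g_def[abs_def])
  then have "\<forall>r. \<exists>Q. \<forall>z. z \<noteq> 0 \<longrightarrow> z\<^sup>2 \<noteq> 1 \<longrightarrow>
      (g r z - g r (inverse z)) / (z - inverse z) = poly Q (z + inverse z)"
    by (intro allI quad_form_antisym)
  from choice[OF this] obtain Q where Q: "\<And>r z. z \<noteq> 0 \<Longrightarrow> z\<^sup>2 \<noteq> 1 \<Longrightarrow>
      (g r z - g r (inverse z)) / (z - inverse z) = poly (Q r) (z + inverse z)"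
    by blast
  define h where "h X y = (\<Sum>r\<le>m. elem_coeff r (X - {y}) * (t ^ r * poly (Q r) y))" for X y
  have "h \<in> symfun_ext"
    unfolding h_def
    by (intro ext_sum ext_mult ext_const ext_poly symfun_remove_in_ext symfun_elem)
  moreover have "sign_sum l k (S - {k}) z =
       h (jouk z ` S) (jouk z k) / (\<Prod>x\<in>jouk z ` S - {jouk z k}. jouk z k - x)"
    if gen: "generic_on S z" and fin: "finite S" and card: "card S = Suc m" and k: "k \<in> S" for S z k
  proof -
    let ?x = "jouk z" and ?R = "jouk z ` S - {jouk z k}"
    have inj: "inj_on ?x S" by (rule jouk_inj[OF gen])
    have R: "?R = ?x ` (S - {k})" using inj k by (auto simp: inj_on_def)
    have injR: "inj_on ?x (S - {k})" using inj by (rule inj_on_subset) auto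
    have cardR: "card ?R = m" using card k fin by (simp add: R card_image[OF injR])
    have zk: "z k \<noteq> 0" "(z k)\<^sup>2 \<noteq> 1" using gen k unfolding generic_on_def by auto
    have pairs: "(\<Prod>j\<in>S - {k}. pair_factor y (z j)) =
        (\<Sum>r\<le>m. elem_coeff r ?R * t ^ r * (y + t\<^sup>2 * inverse y) ^ (m - r)) /
        (\<Prod>x\<in>?R. ?x k - x)"
      if y: "y = z k \<or> y = inverse (z k)" for y
    proof -
      have "pair_factor y (z j) = ((y + t\<^sup>2 * inverse y) - t * ?x j) / (?x k - ?x j)"
        if j: "j \<in> S - {k}" for j
      proof -
        have "z j \<noteq> 0" "z k \<noteq> z j" "z k * z j \<noteq> 1"
          using gen k j unfolding generic_on_def by auto
        moreover from this have "inverse (z k) \<noteq> z j" "inverse (z k) * z j \<noteq> 1"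
          using zk by (auto simp: field_simps)
        ultimately have "pair_factor y (z j) = ((y + t\<^sup>2 * inverse y) - t * (z j + inverse (z j))) /
           ((y + inverse y) - (z j + inverse (z j)))"
          using y zk by (intro pair_factor_eq) auto
        moreover have "y + inverse y = ?x k" using y by (auto simp: jouk_def)
        ultimately show ?thesis by (simp add: jouk_def)
      qed
      then have "(\<Prod>j\<in>S - {k}. pair_factor y (z j)) =
          (\<Prod>j\<in>S - {k}. ((y + t\<^sup>2 * inverse y) - t * ?x j) / (?x k - ?x j))"
        by (intro prod.cong) auto
      also have "\<dots> = (\<Prod>x\<in>?R. ((y + t\<^sup>2 * inverse y) - t * x)) / (\<Prod>x\<in>?R. ?x k - x)"
        unfolding R by (simp add: prod_dividef prod.reindex[OF injR])
      finally show ?thesis using fin by (simp add: prod_linear_elem_coeff cardR)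
    qed
    let ?P = "\<Prod>x\<in>?R. ?x k - x" and ?d = "z k - inverse (z k)"
    have inv: "K_univ l a b t0 t1 t2 t3 (inverse (z k)) = - K_numer l (inverse (z k)) / ?d"
    proof -
      have "inverse (z k) \<noteq> 0" "(inverse (z k))\<^sup>2 \<noteq> 1"
        using zk by (auto simp: power_inverse)
      moreover have "inverse (z k) - inverse (inverse (z k)) = - ?d" by simp
      ultimately have "K_univ l a b t0 t1 t2 t3 (inverse (z k)) = K_numer l (inverse (z k)) / - ?d"
        using K_univ_eq_numer by metis
      then show ?thesis by (simp only: divide_minus_right minus_divide_left)
    qed
    have "sign_sum l k (S - {k}) z =
        K_numer l (z k) / ?d * ((\<Sum>r\<le>m. elem_coeff r ?R * t ^ r * (z k + t\<^sup>2 * inverse (z k)) ^ (m - r)) / ?P)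
        + - K_numer l (inverse (z k)) / ?d *
           ((\<Sum>r\<le>m. elem_coeff r ?R * t ^ r * (inverse (z k) + t\<^sup>2 * inverse (inverse (z k))) ^ (m - r)) / ?P)"
      unfolding sign_sum_def
      by (simp add: pairs inv K_univ_eq_numer[OF zk])
    also have "\<dots> = (\<Sum>r\<le>m. elem_coeff r ?R * (t ^ r *
        ((g r (z k) - g r (inverse (z k))) / ?d))) / ?P"
      unfolding g_def sum_divide_distrib sum_distrib_left sum.distrib[symmetric]
      by (intro sum.cong refl) (simp add: algebra_simps diff_divide_distrib)
    also have "\<dots> = h (?x ` S) (?x k) / ?P"
      using Q[OF zk] unfolding h_def by (simp add: jouk_def)
    finally show ?thesis .
  qed
  ultimately show ?thesis by blast
qed

text \<open>
  Induction on the list of parts: the sum over the first variable is a Lagrange sum over the set of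
  all \<open>x\<^sub>i\<close>.
\<close>

theorem peel_sum_symfun:
  "\<exists>f\<in>symfun. \<forall>S z. generic_on S z \<longrightarrow> finite S \<longrightarrow> card S = length ls \<longrightarrow>
     peel_sum ls S z = f (jouk z ` S)"
proof (induction ls)
  case Nil
  show ?case by (rule bexI[OF _ symfun_const[of 1]]) auto
next
  case (Cons l ls)
  then obtain f where f: "f \<in> symfun"
    "\<And>S z. generic_on S z \<Longrightarrow> finite S \<Longrightarrow> card S = length ls \<Longrightarrow> peel_sum ls S z = f (jouk z ` S)"
    by blast
  obtain h where h: "h \<in> symfun_ext" "\<And>S z k. generic_on S z \<Longrightarrow> finite S \<Longrightarrow>
     card S = Suc (length ls) \<Longrightarrow> k \<in> S \<Longrightarrow> sign_sum l k (S - {k}) z =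
       h (jouk z ` S) (jouk z k) / (\<Prod>x\<in>jouk z ` S - {jouk z k}. jouk z k - x)"
    using sign_sum_in_ext[of "length ls" l] by blast
  define F where "F X = (\<Sum>y\<in>X. h X y * f (X - {y}) / (\<Prod>x\<in>X - {y}. y - x))" for X
  have "F \<in> symfun"
    unfolding F_def
    by (intro lagrange_sum_symfun ext_mult h(1) symfun_remove_in_ext f(1))
  moreover have "peel_sum (l # ls) S z = F (jouk z ` S)"
    if S: "generic_on S z" "finite S" "card S = length (l # ls)" for S z
  proof -
    let ?x = "jouk z"
    have inj: "inj_on ?x S" by (rule jouk_inj[OF S(1)])
    have "peel_sum ls (S - {k}) z = f (?x ` S - {?x k})" if k: "k \<in> S" for k
    proof -
      have "?x ` (S - {k}) = ?x ` S - {?x k}" using inj k by (auto simp: inj_on_def)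
      then show ?thesis
        using f(2)[OF generic_on_subset[OF S(1)], of "S - {k}"] S k by auto
    qed
    then have "peel_sum (l # ls) S z = (\<Sum>k\<in>S. h (?x ` S) (?x k) /
        (\<Prod>x\<in>?x ` S - {?x k}. ?x k - x) * f (?x ` S - {?x k}))"
      using S h(2)[OF S(1,2)] by simp
    also have "\<dots> = F (?x ` S)"
      unfolding F_def by (simp add: sum.reindex[OF inj])
    finally show ?thesis .
  qed
  ultimately show ?case by blast
qed

end

section \<open>The hyperoctahedral sum as an iterated peeling\<close>

text \<open>
  The map is injective because a permutation is the identity outside \<open>{1..n}\<close>, and surjective because
  both sides have \<open>n!\<close> elements.
\<close>

lemma bij_betw_permutes_lists:
  "bij_betw (\<lambda>\<rho>. map \<rho> [1..<Suc n]) {\<rho>. \<rho> permutes {1..n}} (permutations_of_set {1..n})"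
proof -
  let ?f = "\<lambda>\<rho>::nat \<Rightarrow> nat. map \<rho> [1..<Suc n]"
  have inj: "inj_on ?f {\<rho>. \<rho> permutes {1..n}}"
  proof (rule inj_onI, rule ext)
    fix \<rho> \<sigma> i assume *: "\<rho> \<in> {\<rho>. \<rho> permutes {1..n}}" "\<sigma> \<in> {\<rho>. \<rho> permutes {1..n}}" "?f \<rho> = ?f \<sigma>"
    then have "\<forall>i\<in>{1..n}. \<rho> i = \<sigma> i"
      by (simp only: map_eq_conv set_upt atLeastLessThanSuc_atLeastAtMost)
    then show "\<rho> i = \<sigma> i"
      using * permutes_not_in[of \<rho> "{1..n}" i] permutes_not_in[of \<sigma> "{1..n}" i]
      by (cases "i \<in> {1..n}") auto
  qed
  have sub: "?f ` {\<rho>. \<rho> permutes {1..n}} \<subseteq> permutations_of_set {1..n}"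
  proof safe
    fix \<rho> assume p: "\<rho> permutes {1..n}"
    have "set (?f \<rho>) = {1..n}"
      using permutes_image[OF p] by (simp add: atLeastLessThanSuc_atLeastAtMost del: upt_Suc)
    moreover have "distinct (?f \<rho>)"
      using permutes_inj_on[OF p] by (simp add: distinct_map del: upt_Suc)
    ultimately show "?f \<rho> \<in> permutations_of_set {1..n}" by (rule permutations_of_setI)
  qed
  have "card (?f ` {\<rho>. \<rho> permutes {1..n}}) = card (permutations_of_set {1..n})"
    unfolding card_image[OF inj] by (simp add: card_permutations[of _ n])
  then have "?f ` {\<rho>. \<rho> permutes {1..n}} = permutations_of_set {1..n}"
    using sub by (intro card_subset_eq) auto
  with inj show ?thesis by (simp add: bij_betw_def)
qed

context koornwinder
begin

text \<open>
  The summand of the iterated sum that removes the variables in the order given by \<open>xs\<close>.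
\<close>

primrec peel_term :: "nat list \<Rightarrow> nat list \<Rightarrow> (nat \<Rightarrow> complex) \<Rightarrow> complex" where
  "peel_term [] xs z = 1"
| "peel_term (l # ls) xs z = sign_sum l (hd xs) (set (tl xs)) z * peel_term ls (tl xs) z"

lemma peel_sum_permutations:
  assumes "finite S" "card S = length ls"
  shows "peel_sum ls S z = (\<Sum>xs\<in>permutations_of_set S. peel_term ls xs z)"
  using assms
proof (induction ls arbitrary: S)
  case Nil
  then show ?case by simp
next
  case (Cons l ls)
  then have "S \<noteq> {}" by auto
  have "(\<Sum>xs\<in>permutations_of_set S. peel_term (l # ls) xs z) =
      (\<Sum>k\<in>S. \<Sum>xs\<in>(#) k ` permutations_of_set (S - {k}). peel_term (l # ls) xs z)"
    unfolding permutations_of_set_nonempty[OF \<open>S \<noteq> {}\<close>]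
    by (rule sum.UNION_disjoint[OF Cons.prems(1)]) auto
  also have "\<dots> = (\<Sum>k\<in>S. \<Sum>xs\<in>permutations_of_set (S - {k}).
                     sign_sum l k (set xs) z * peel_term ls xs z)"
    by (rule sum.cong[OF refl], subst sum.reindex) auto
  also have "\<dots> = (\<Sum>k\<in>S. sign_sum l k (S - {k}) z * (\<Sum>xs\<in>permutations_of_set (S - {k}). peel_term ls xs z))"
    unfolding sum_distrib_left by (intro sum.cong refl) (simp add: permutations_of_setD)
  also have "\<dots> = peel_sum (l # ls) S z"
    using Cons by simp
  finally show ?case ..
qed

lemma peel_term_map:
  "peel_term (map lam [k..<Suc n]) (map \<rho> [k..<Suc n]) z =
     (\<Prod>i=k..n. sign_sum (lam i) (\<rho> i) (\<rho> ` {Suc i..n}) z)"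
proof (induction "Suc n - k" arbitrary: k)
  case 0
  then show ?case by simp
next
  case (Suc d)
  then have k: "k \<le> n" by simp
  then have u: "[k..<Suc n] = k # [Suc k..<Suc n]" by (simp add: upt_conv_Cons del: upt_Suc)
  have "(\<Prod>i=k..n. sign_sum (lam i) (\<rho> i) (\<rho> ` {Suc i..n}) z) =
     sign_sum (lam k) (\<rho> k) (\<rho> ` {Suc k..n}) z *
     (\<Prod>i=Suc k..n. sign_sum (lam i) (\<rho> i) (\<rho> ` {Suc i..n}) z)"
    using k by (rule prod.atLeast_Suc_atMost)
  moreover have "peel_term (map lam [Suc k..<Suc n]) (map \<rho> [Suc k..<Suc n]) z =
      (\<Prod>i=Suc k..n. sign_sum (lam i) (\<rho> i) (\<rho> ` {Suc i..n}) z)"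
    using Suc by (intro Suc.hyps(1)) simp
  ultimately show ?case
    unfolding u by (simp add: atLeastLessThanSuc_atLeastAtMost del: upt_Suc)
qed

lemma pair_factor_sign: "e \<in> {1, -1} \<Longrightarrow> pair_factor x (y powi e) = pair_factor x y"
  by (auto simp: pair_factor_def mult_ac)

lemma K_summand_act_point:
  assumes \<rho>: "\<rho> permutes {1..n}" and \<epsilon>: "\<epsilon> \<in> {1..n} \<rightarrow>\<^sub>E {1, -1}"
  shows "K_summand n lam t a b t0 t1 t2 t3 (act_point (\<rho>, \<epsilon>) z) =
    (\<Prod>i\<in>{1..n}. K_univ (lam i) a b t0 t1 t2 t3 (z (\<rho> i) powi \<epsilon> i) *
       (\<Prod>j\<in>\<rho> ` {Suc i..n}. pair_factor (z (\<rho> i) powi \<epsilon> i) (z j)))"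
proof -
  let ?y = "act_point (\<rho>, \<epsilon>) z"
  have pairs: "{(i, j). 1 \<le> i \<and> i < j \<and> j \<le> n} = Sigma {1..n} (\<lambda>i. {Suc i..n})" by auto
  have "K_summand n lam t a b t0 t1 t2 t3 ?y =
    (\<Prod>i\<in>{1..n}. K_univ (lam i) a b t0 t1 t2 t3 (?y i) * (\<Prod>j\<in>{Suc i..n}. pair_factor (?y i) (?y j)))"
    unfolding K_summand_def pairs
    by (subst prod.Sigma[symmetric]) (auto simp: prod.distrib pair_factor_def)
  also have "\<dots> = (\<Prod>i\<in>{1..n}. K_univ (lam i) a b t0 t1 t2 t3 (z (\<rho> i) powi \<epsilon> i) *
       (\<Prod>j\<in>\<rho> ` {Suc i..n}. pair_factor (z (\<rho> i) powi \<epsilon> i) (z j)))"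
  proof (rule prod.cong[OF refl], rule arg_cong2[of _ _ _ _ "(*)"])
    fix i assume i: "i \<in> {1..n}"
    show "K_univ (lam i) a b t0 t1 t2 t3 (?y i) = K_univ (lam i) a b t0 t1 t2 t3 (z (\<rho> i) powi \<epsilon> i)"
      by (simp add: act_point_def)
    have "(\<Prod>j\<in>\<rho> ` {Suc i..n}. pair_factor (z (\<rho> i) powi \<epsilon> i) (z j)) =
          (\<Prod>j\<in>{Suc i..n}. pair_factor (z (\<rho> i) powi \<epsilon> i) (z (\<rho> j)))"
      by (simp add: prod.reindex[OF permutes_inj_on[OF \<rho>]])
    also have "\<dots> = (\<Prod>j\<in>{Suc i..n}. pair_factor (?y i) (?y j))"
    proof (intro prod.cong refl)
      fix j assume "j \<in> {Suc i..n}"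
      then have "\<epsilon> j \<in> {1, -1}" using \<epsilon> i by (intro PiE_mem[OF \<epsilon>]) auto
      then show "pair_factor (z (\<rho> i) powi \<epsilon> i) (z (\<rho> j)) = pair_factor (?y i) (?y j)"
        by (simp only: act_point_def pair_factor_sign fst_conv snd_conv)
    qed
    finally show "(\<Prod>j\<in>{Suc i..n}. pair_factor (?y i) (?y j)) =
        (\<Prod>j\<in>\<rho> ` {Suc i..n}. pair_factor (z (\<rho> i) powi \<epsilon> i) (z j))" ..
  qed
  finally show ?thesis .
qed

text \<open>
  A pair factor only notices the sign of its first variable, so for a fixed permutation the sum over
  all sign vectors is a product of sums over single signs.
\<close>

theorem hyperoctahedral_sum_eq_peel_sum:
  "(\<Sum>w\<in>hyperoctahedral n. act_fun w (K_summand n lam t a b t0 t1 t2 t3) z) =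
     peel_sum (map lam [1..<Suc n]) {1..n} z"
proof -
  let ?G = "\<lambda>\<rho> i e. K_univ (lam i) a b t0 t1 t2 t3 (z (\<rho> i) powi e) *
       (\<Prod>j\<in>\<rho> ` {Suc i..n}. pair_factor (z (\<rho> i) powi e) (z j))"
  have "(\<Sum>w\<in>hyperoctahedral n. act_fun w (K_summand n lam t a b t0 t1 t2 t3) z) =
     (\<Sum>\<rho> | \<rho> permutes {1..n}. \<Sum>\<epsilon>\<in>{1..n} \<rightarrow>\<^sub>E {1, -1}.
        K_summand n lam t a b t0 t1 t2 t3 (act_point (\<rho>, \<epsilon>) z))"
    unfolding hyperoctahedral_def act_fun_def by (simp add: sum.cartesian_product split_def)
  also have "\<dots> = (\<Sum>\<rho> | \<rho> permutes {1..n}. \<Sum>\<epsilon>\<in>{1..n} \<rightarrow>\<^sub>E {1, -1::int}. \<Prod>i\<in>{1..n}. ?G \<rho> i (\<epsilon> i))"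
    by (intro sum.cong refl) (simp only: K_summand_act_point mem_Collect_eq)
  also have "\<dots> = (\<Sum>\<rho> | \<rho> permutes {1..n}. \<Prod>i\<in>{1..n}. \<Sum>e\<in>{1, -1}. ?G \<rho> i e)"
    by (intro sum.cong refl prod_sum_PiE[symmetric]) auto
  also have "\<dots> = (\<Sum>\<rho> | \<rho> permutes {1..n}. peel_term (map lam [1..<Suc n]) (map \<rho> [1..<Suc n]) z)"
    by (simp only: peel_term_map sign_sum_def)
  also have "\<dots> = (\<Sum>xs\<in>permutations_of_set {1..n}. peel_term (map lam [1..<Suc n]) xs z)"
    by (rule sum.reindex_bij_betw[OF bij_betw_permutes_lists])
  also have "\<dots> = peel_sum (map lam [1..<Suc n]) {1..n} z"
    by (subst peel_sum_permutations) auto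
  finally show ?thesis .
qed

end

section \<open>Asymptotics along a monomial curve\<close>

lemma inverse_power_diff:
  fixes r :: complex
  assumes r: "r \<noteq> 0"
  shows "inverse (inverse r ^ i) * inverse r ^ j = (if j \<le> i then r ^ (i - j) else inverse (r ^ (j - i)))"
proof (cases "j \<le> i")
  case True
  then obtain d where "i = j + d" using le_Suc_ex[of j i] by auto
  then show ?thesis using r by (simp add: power_add power_inverse)
next
  case False
  then obtain d where "j = i + d" "d \<noteq> 0" using le_Suc_ex[of i j] by auto
  then show ?thesis using r by (simp add: power_add power_inverse)
qed

lemma tendsto_power_0: "0 < k \<Longrightarrow> ((\<lambda>r::complex. r ^ k) \<longlongrightarrow> 0) (at 0)"
  by (rule tendsto_eq_intros refl)+ auto

lemma filterlim_power_at_0: "0 < k \<Longrightarrow> filterlim (\<lambda>r::complex. r ^ k) (at 0) (at 0)"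
  unfolding filterlim_at by (auto simp: tendsto_power_0 eventually_at_filter)

text \<open>
  The exponents \<open>M i\<close> are positive, so the coordinates tend to infinity as \<open>r\<close> tends to \<open>0\<close>. A
  complex parameter is used to have plain powers of \<open>r\<close> and limits at \<open>0\<close>.
\<close>

definition curve :: "(nat \<Rightarrow> nat) \<Rightarrow> complex \<Rightarrow> nat \<Rightarrow> complex" where
  "curve M r i = inverse r ^ M i"

definition decreasing_on :: "nat set \<Rightarrow> (nat \<Rightarrow> nat) \<Rightarrow> bool" where
  "decreasing_on S M \<longleftrightarrow> (\<forall>i\<in>S. 0 < M i) \<and> (\<forall>i\<in>S. \<forall>j\<in>S. i < j \<longrightarrow> M j < M i)"

lemma decreasing_on_subset: "decreasing_on S M \<Longrightarrow> T \<subseteq> S \<Longrightarrow> decreasing_on T M"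
  unfolding decreasing_on_def by blast

definition rank_in :: "nat set \<Rightarrow> nat \<Rightarrow> nat" where
  "rank_in S k = card {j \<in> S. j < k}"

text \<open>
  The sum of \<open>ls ! i\<close> times \<open>M\<close> at the \<open>i\<close>-th smallest element of \<open>S\<close>. For decreasing \<open>ls\<close> and \<open>M\<close>
  this is the largest exponent that any assignment of parts to variables can produce.
\<close>

primrec weight :: "nat list \<Rightarrow> nat set \<Rightarrow> (nat \<Rightarrow> nat) \<Rightarrow> nat" where
  "weight [] S M = 0"
| "weight (l # ls) S M = l * M (Min S) + weight ls (S - {Min S}) M"

lemma rank_in_Min:
  assumes "finite S" "S \<noteq> {}"
  shows "rank_in S (Min S) = 0"
proof -
  have "{j \<in> S. j < Min S} = {}" using assms by (auto simp: not_less)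
  thus ?thesis unfolding rank_in_def by simp
qed

lemma rank_in_remove_Min:
  assumes "finite S" "k \<in> S" "k \<noteq> Min S"
  shows "rank_in S k = Suc (rank_in (S - {Min S}) k)"
proof -
  have "{j \<in> S. j < k} = insert (Min S) {j \<in> S - {Min S}. j < k}"
    using assms by (auto intro: Min_in le_neq_trans)
  then show ?thesis using assms unfolding rank_in_def by simp
qed

text \<open>
  If the first part goes to \<open>k\<close> instead of \<open>Min S\<close>, the parts of the variables below \<open>k\<close> shift by one,
  and the exponent drops by \<open>\<Sum>(M i - M k) (\<lambda>\<^sub>i - \<lambda>\<^sub>i\<^sub>+\<^sub>1)\<close>, summed over the variables \<open>i\<close> below \<open>k\<close>. There
  is no loss exactly when all the parts involved are equal.
\<close>

lemma weight_remove:
  assumes "finite S" "card S = Suc (length ls)" "k \<in> S" "decreasing_on S M" "sorted_wrt (\<ge>) (l # ls)"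
  shows "\<exists>gap. weight (l # ls) S M = l * M k + weight ls (S - {k}) M + gap \<and>
           (gap = 0 \<longleftrightarrow> (\<forall>i\<le>rank_in S k. (l # ls) ! i = l))"
  using assms
proof (induction ls arbitrary: l S)
  case Nil
  then obtain x where "S = {x}" by (auto simp: card_Suc_eq)
  then have "k = x" "{j \<in> S. j < k} = {}" using Nil by auto
  then have "rank_in S k = 0" by (simp only: rank_in_def card.empty)
  then show ?case using \<open>S = {x}\<close> \<open>k = x\<close> by simp
next
  case (Cons l2 ls)
  show ?case
  proof (cases "k = Min S")
    case True
    then have "rank_in S k = 0" using rank_in_Min[of S] Cons.prems by auto
    then show ?thesis using True by simp
  next
    case False
    define m where "m = Min S"
    have "m \<in> S" unfolding m_def using Cons.prems(1,3) by (intro Min_in) auto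
    moreover have "m \<noteq> k" using False by (simp add: m_def)
    ultimately have m: "m \<in> S" "m \<noteq> k" by auto
    have "m < k" using False Cons.prems by (auto simp: m_def intro: le_neq_trans)
    then have M: "M k < M m" using m Cons.prems unfolding decreasing_on_def by blast
    have l2: "l2 \<le> l" using Cons.prems by simp
    obtain gap where gap: "weight (l2 # ls) (S - {m}) M = l2 * M k + weight ls (S - {m} - {k}) M + gap"
      "gap = 0 \<longleftrightarrow> (\<forall>i\<le>rank_in (S - {m}) k. (l2 # ls) ! i = l2)"
    proof -
      have "decreasing_on (S - {m}) M" using Cons.prems(4) by (rule decreasing_on_subset) auto
      moreover have "card (S - {m}) = Suc (length ls)" using Cons.prems(2) m(1) by simp
      moreover have "sorted_wrt (\<ge>) (l2 # ls)" using Cons.prems(5) by simp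
      moreover have "finite (S - {m})" "k \<in> S - {m}" using Cons.prems(1,3) m(2) by auto
      ultimately show ?thesis using Cons.IH[of "S - {m}" l2] that by blast
    qed
    have Min': "Min (S - {k}) = m"
    proof (rule Min_eqI)
      fix y assume "y \<in> S - {k}"
      then show "m \<le> y" unfolding m_def using Cons.prems(1) by simp
    qed (use m Cons.prems(1) in auto)
    have sets: "S - {k} - {m} = S - {m} - {k}" by auto
    have "weight (l # l2 # ls) S M = l * M m + (l2 * M k + weight ls (S - {m} - {k}) M + gap)"
      by (simp only: weight.simps(2)[of l] m_def[symmetric] gap(1))
    also have "\<dots> = l * M k + (l2 * M m + weight ls (S - {m} - {k}) M) + (gap + (l - l2) * (M m - M k))"
    proof -
      obtain d where d: "l = l2 + d" using le_Suc_ex[OF l2] by auto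
      obtain e where e: "M m = M k + e" using le_Suc_ex[OF less_imp_le[OF M]] by auto
      show ?thesis unfolding d e by (simp add: distrib_left distrib_right)
    qed
    also have "l2 * M m + weight ls (S - {m} - {k}) M = weight (l2 # ls) (S - {k}) M"
      by (simp only: weight.simps(2) Min' sets)
    finally have "weight (l # l2 # ls) S M = l * M k + weight (l2 # ls) (S - {k}) M +
        (gap + (l - l2) * (M m - M k))" .
    moreover have "gap + (l - l2) * (M m - M k) = 0 \<longleftrightarrow> (\<forall>i\<le>rank_in S k. (l # l2 # ls) ! i = l)"
    proof -
      have r: "rank_in S k = Suc (rank_in (S - {m}) k)"
        unfolding m_def by (rule rank_in_remove_Min[OF Cons.prems(1,3) False])
      let ?q = "rank_in (S - {m}) k"
      have "(\<forall>i\<le>rank_in S k. (l # l2 # ls) ! i = l) \<longleftrightarrow> (\<forall>i\<le>?q. (l2 # ls) ! i = l)"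
        using All_less_Suc2[of "Suc ?q" "\<lambda>i. (l # l2 # ls) ! i = l"]
        by (simp only: r less_Suc_eq_le nth_Cons_0 nth_Cons_Suc simp_thms)
      also have "\<dots> \<longleftrightarrow> l2 = l \<and> (\<forall>i\<le>?q. (l2 # ls) ! i = l2)"
      proof
        assume eq: "\<forall>i\<le>?q. (l2 # ls) ! i = l"
        then have "l2 = l" by (metis le0 nth_Cons_0)
        with eq show "l2 = l \<and> (\<forall>i\<le>?q. (l2 # ls) ! i = l2)" by blast
      qed blast
      also have "\<dots> \<longleftrightarrow> l2 = l \<and> gap = 0" by (simp only: gap(2))
      also have "\<dots> \<longleftrightarrow> gap = 0 \<and> (l - l2) * (M m - M k) = 0"
      proof -
        have "(l - l2) * (M m - M k) = 0 \<longleftrightarrow> l2 = l" using l2 M by auto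
        then show ?thesis by (simp only: conj_commute)
      qed
      finally show ?thesis by (simp only: add_is_0)
    qed
    ultimately show ?thesis by (intro exI conjI)
  qed
qed

lemma sum_rank_in:
  assumes "finite S"
  shows "(\<Sum>k\<in>S. g (rank_in S k)) = (\<Sum>i<card S. g i)"
  using assms
proof (induction S rule: finite_linorder_max_induct)
  case empty
  show ?case by simp
next
  case (insert m S)
  have "rank_in (insert m S) k = rank_in S k" if "k \<in> S" for k
  proof -
    have "{j \<in> insert m S. j < k} = {j \<in> S. j < k}" using insert.hyps that by auto
    then show ?thesis by (simp add: rank_in_def)
  qed
  moreover have "rank_in (insert m S) m = card S"
  proof -
    have "{j \<in> insert m S. j < m} = S" using insert.hyps by auto
    then show ?thesis by (simp add: rank_in_def)
  qed
  moreover have "m \<notin> S" using insert.hyps by auto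
  ultimately show ?case using insert by (simp add: add.commute)
qed

lemma tendsto_power_indicator:
  "((\<lambda>r::complex. r ^ k) \<longlongrightarrow> (if k = 0 then 1 else 0)) (at 0)"
  by (cases "k = 0") (auto simp: tendsto_power_0)

context koornwinder
begin

text \<open>
  The relative weight, up to sign, of choosing the exponent \<open>-1\<close> for a variable that carries the part \<open>l\<close>. A
  reversed variable with a part \<open>l \<ge> 2\<close> contributes only terms of lower order.
\<close>

definition sign_const :: "nat \<Rightarrow> complex" where
  "sign_const l = (if l = 0 then a * b else if l = 1 then t0 * t1 * t2 * t3 else 0)"

lemma K_univ_limit_infinity:
  "((\<lambda>q. K_univ l a b t0 t1 t2 t3 (inverse q) * q ^ l) \<longlongrightarrow> 1) (at 0)"
proof (cases "l = 0")
  case True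
  have "((\<lambda>q. (1 - a * q) * (1 - b * q) / (1 - q ^ 2)) \<longlongrightarrow> 1) (at 0)"
    by (rule tendsto_eq_intros refl | simp)+
  then show ?thesis by (simp add: True K_univ_def)
next
  case False
  have "((\<lambda>q. (1 - t0 * q) * (1 - t1 * q) * (1 - t2 * q) * (1 - t3 * q) / (1 - q ^ 2)) \<longlongrightarrow> 1) (at 0)"
    by (rule tendsto_eq_intros refl | simp)+
  moreover have "eventually (\<lambda>q. (1 - t0 * q) * (1 - t1 * q) * (1 - t2 * q) * (1 - t3 * q) / (1 - q ^ 2) =
      K_univ l a b t0 t1 t2 t3 (inverse q) * q ^ l) (at 0)"
    unfolding eventually_at_filter
    by (intro always_eventually) (use False in \<open>auto simp: K_univ_def power_inverse\<close>)
  ultimately show ?thesis by (rule Lim_transform_eventually)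
qed

lemma K_univ_limit_zero:
  "((\<lambda>q. K_univ l a b t0 t1 t2 t3 q * q ^ l) \<longlongrightarrow> - sign_const l) (at 0)"
proof (cases "l = 0")
  case True
  have "((\<lambda>q. (q - a) * (q - b) / (q ^ 2 - 1)) \<longlongrightarrow> - (a * b)) (at 0)"
    by (rule tendsto_eq_intros refl | simp)+
  moreover have "eventually (\<lambda>q. (q - a) * (q - b) / (q ^ 2 - 1) =
      K_univ l a b t0 t1 t2 t3 q * q ^ l) (at 0)"
    unfolding eventually_at_filter
  proof (intro always_eventually allI impI)
    fix q :: complex assume "q \<noteq> 0"
    then have "1 - a * inverse q = (q - a) / q" "1 - b * inverse q = (q - b) / q"
      "1 - inverse q ^ 2 = (q ^ 2 - 1) / (q * q)"
      by (simp_all add: field_simps power2_eq_square)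
    then show "(q - a) * (q - b) / (q ^ 2 - 1) = K_univ l a b t0 t1 t2 t3 q * q ^ l"
      using \<open>q \<noteq> 0\<close> True by (simp add: K_univ_def)
  qed
  ultimately have "((\<lambda>q. K_univ l a b t0 t1 t2 t3 q * q ^ l) \<longlongrightarrow> - (a * b)) (at 0)"
    by (rule Lim_transform_eventually)
  then show ?thesis using True by (simp add: sign_const_def)
next
  case False
  have "((\<lambda>q. q ^ (2 * l - 2) * ((q - t0) * (q - t1) * (q - t2) * (q - t3) / (q ^ 2 - 1))) \<longlongrightarrow>
     (if 2 * l - 2 = 0 then 1 else 0) * (- (t0 * t1 * t2 * t3))) (at 0)"
  proof (rule tendsto_mult[OF tendsto_power_indicator])
    show "((\<lambda>q. (q - t0) * (q - t1) * (q - t2) * (q - t3) / (q ^ 2 - 1)) \<longlongrightarrow> - (t0 * t1 * t2 * t3)) (at 0)"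
      by (rule tendsto_eq_intros refl | simp)+
  qed
  moreover have "(if 2 * l - 2 = 0 then 1 else 0) * (- (t0 * t1 * t2 * t3)) = - sign_const l"
    using False by (auto simp: sign_const_def)
  ultimately have lim: "((\<lambda>q. q ^ (2 * l - 2) * ((q - t0) * (q - t1) * (q - t2) * (q - t3) / (q ^ 2 - 1))) \<longlongrightarrow>
     - sign_const l) (at 0)"
    by (simp only:)
  have "eventually (\<lambda>q. q ^ (2 * l - 2) * ((q - t0) * (q - t1) * (q - t2) * (q - t3) / (q ^ 2 - 1)) =
      K_univ l a b t0 t1 t2 t3 q * q ^ l) (at 0)"
    unfolding eventually_at_filter
  proof (intro always_eventually allI impI)
    fix q :: complex assume q: "q \<noteq> 0"
    obtain d where d: "l = Suc d" using False by (cases l) auto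
    have lin: "1 - c * inverse q = (q - c) / q" for c using q by (simp add: field_simps)
    have den: "1 - inverse q ^ 2 = (q ^ 2 - 1) / (q * q)"
      using q by (simp add: field_simps power2_eq_square)
    have pw: "q ^ (2 * l - 2) * (q * q) = q ^ l * q ^ l"
      by (simp add: d mult_2 power_add)
    have "K_univ l a b t0 t1 t2 t3 q * q ^ l = (q ^ l * q ^ l) * ((q - t0) * (q - t1) * (q - t2) * (q - t3) /
            ((q * q) * (q ^ 2 - 1)))"
      unfolding K_univ_def lin den using False q by simp
    also have "\<dots> = q ^ (2 * l - 2) * ((q - t0) * (q - t1) * (q - t2) * (q - t3) / (q ^ 2 - 1))"
      unfolding pw[symmetric] using q by simp
    finally show "q ^ (2 * l - 2) * ((q - t0) * (q - t1) * (q - t2) * (q - t3) / (q ^ 2 - 1)) =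
      K_univ l a b t0 t1 t2 t3 q * q ^ l" ..
  qed
  then show ?thesis by (rule Lim_transform_eventually[OF lim])
qed

definition ratio_factor :: "complex \<Rightarrow> complex" where
  "ratio_factor x = (1 - t * x) / (1 - x)"

lemma pair_factor_ratio: "pair_factor x y = ratio_factor (inverse x * y) * ratio_factor (inverse x * inverse y)"
  by (simp add: pair_factor_def ratio_factor_def mult.assoc)

text \<open>
  The limit of \<open>(1 - t q) / (1 - q)\<close> is \<open>t\<close> when \<open>q\<close> tends to infinity and \<open>1\<close> when \<open>q\<close> tends to \<open>0\<close>.
\<close>

lemma ratio_factor_limit:
  assumes "i \<noteq> j"
  shows "((\<lambda>r. ratio_factor (inverse (inverse r ^ i) * inverse r ^ j)) \<longlongrightarrow> (if i < j then t else 1)) (at 0)"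
proof (cases "i < j")
  case True
  have "((\<lambda>q. (q - t) / (q - 1)) \<longlongrightarrow> t) (at 0)"
    by (rule tendsto_eq_intros refl | simp)+
  then have "((\<lambda>r. (r ^ (j - i) - t) / (r ^ (j - i) - 1)) \<longlongrightarrow> t) (at 0)"
    by (rule filterlim_compose) (use True in \<open>auto intro!: filterlim_power_at_0\<close>)
  moreover have "eventually (\<lambda>r. (r ^ (j - i) - t) / (r ^ (j - i) - 1) =
      ratio_factor (inverse (inverse r ^ i) * inverse r ^ j)) (at 0)"
    unfolding eventually_at_filter
  proof (intro always_eventually allI impI)
    fix r :: complex assume r: "r \<noteq> 0"
    let ?q = "r ^ (j - i)"
    have "1 - t * inverse ?q = (?q - t) / ?q" "1 - inverse ?q = (?q - 1) / ?q"
      using r by (simp_all add: field_simps)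
    then show "(?q - t) / (?q - 1) = ratio_factor (inverse (inverse r ^ i) * inverse r ^ j)"
      using True r by (simp add: inverse_power_diff ratio_factor_def)
  qed
  ultimately have "((\<lambda>r. ratio_factor (inverse (inverse r ^ i) * inverse r ^ j)) \<longlongrightarrow> t) (at 0)"
    by (rule Lim_transform_eventually)
  then show ?thesis using True by simp
next
  case False
  have "((\<lambda>q. (1 - t * q) / (1 - q)) \<longlongrightarrow> 1) (at 0)"
    by (rule tendsto_eq_intros refl | simp)+
  then have "((\<lambda>r. (1 - t * r ^ (i - j)) / (1 - r ^ (i - j))) \<longlongrightarrow> 1) (at 0)"
    by (rule filterlim_compose) (use False assms in \<open>auto intro!: filterlim_power_at_0\<close>)
  moreover have "eventually (\<lambda>r. (1 - t * r ^ (i - j)) / (1 - r ^ (i - j)) =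
      ratio_factor (inverse (inverse r ^ i) * inverse r ^ j)) (at 0)"
    unfolding eventually_at_filter
    by (intro always_eventually) (use False in \<open>auto simp: inverse_power_diff ratio_factor_def\<close>)
  ultimately have "((\<lambda>r. ratio_factor (inverse (inverse r ^ i) * inverse r ^ j)) \<longlongrightarrow> 1) (at 0)"
    by (rule Lim_transform_eventually)
  then show ?thesis using False by simp
qed

lemma pair_factor_limit:
  assumes "0 < i" "0 < j" "i \<noteq> j"
  shows "((\<lambda>r. pair_factor (inverse r ^ i) (inverse r ^ j)) \<longlongrightarrow> (if i < j then t else 1)) (at 0)"
    and "((\<lambda>r. pair_factor (r ^ i) (inverse r ^ j)) \<longlongrightarrow> (if i < j then t else t\<^sup>2)) (at 0)"
proof -
  have 1: "((\<lambda>r. ratio_factor (r ^ (i + j))) \<longlongrightarrow> 1) (at 0)"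
    using ratio_factor_limit[of "i + j" 0] assms by (simp add: power_inverse)
  have 2: "((\<lambda>r. ratio_factor (inverse r ^ (i + j))) \<longlongrightarrow> t) (at 0)"
    using ratio_factor_limit[of 0 "i + j"] assms by simp
  have "((\<lambda>r. ratio_factor (inverse (inverse r ^ i) * inverse r ^ j) * ratio_factor (r ^ (i + j))) \<longlongrightarrow>
      (if i < j then t else 1) * 1) (at 0)"
    by (intro tendsto_mult ratio_factor_limit 1 assms)
  then show "((\<lambda>r. pair_factor (inverse r ^ i) (inverse r ^ j)) \<longlongrightarrow> (if i < j then t else 1)) (at 0)"
    by (simp add: pair_factor_ratio power_add power_inverse)
  have "((\<lambda>r. ratio_factor (inverse r ^ (i + j)) * ratio_factor (inverse (inverse r ^ j) * inverse r ^ i)) \<longlongrightarrow>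
      t * (if j < i then t else 1)) (at 0)"
    by (intro tendsto_mult ratio_factor_limit 2 assms(3)[symmetric])
  moreover have "t * (if j < i then t else 1) = (if i < j then t else t\<^sup>2)"
    using assms by (simp add: power2_eq_square)
  ultimately show "((\<lambda>r. pair_factor (r ^ i) (inverse r ^ j)) \<longlongrightarrow> (if i < j then t else t\<^sup>2)) (at 0)"
    by (simp add: pair_factor_ratio power_add power_inverse mult.commute)
qed

lemma prod_if_rank:
  assumes "finite S" "k \<in> S" "decreasing_on S M"
  shows "(\<Prod>j\<in>S - {k}. if M k < M j then (x::complex) else y) = x ^ rank_in S k * y ^ (card S - 1 - rank_in S k)"
proof -
  have "M k < M j \<longleftrightarrow> j < k" if "j \<in> S - {k}" for j
  proof -
    have "j < k \<or> k < j" using that by auto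
    moreover have "j < k \<Longrightarrow> M k < M j" "k < j \<Longrightarrow> M j < M k"
      using that assms(2,3) unfolding decreasing_on_def by blast+
    ultimately show ?thesis by linarith
  qed
  then have "{j \<in> S - {k}. M k < M j} = {j \<in> S. j < k}" by auto
  moreover have "card ((S - {k}) \<inter> - {j. M k < M j}) = card (S - {k}) - card {j \<in> S - {k}. M k < M j}"
    using assms by (subst card_Diff_subset[symmetric]) (auto intro!: arg_cong[of _ _ card])
  moreover have "card (S - {k}) = card S - 1" using assms by simp
  ultimately show ?thesis using assms
    by (subst prod.If_cases) (auto simp: rank_in_def Int_def)
qed

text \<open>
  With positive exponent, exactly the variables before \<open>k\<close> contribute a factor \<open>t\<close> each. With negative
  exponent, these still contribute \<open>t\<close>, and each variable after \<open>k\<close> contributes \<open>t\<^sup>2\<close>.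
\<close>

lemma sign_sum_limit:
  assumes "finite S" "k \<in> S" "decreasing_on S M"
  shows "((\<lambda>r. sign_sum l k (S - {k}) (curve M r) * r ^ (l * M k)) \<longlongrightarrow>
     t ^ rank_in S k * (1 - sign_const l * t ^ (2 * (card S - 1 - rank_in S k)))) (at 0)"
proof -
  let ?U = "K_univ l a b t0 t1 t2 t3"
  have Mk: "0 < M k" using assms unfolding decreasing_on_def by blast
  have U: "((\<lambda>r. ?U (inverse (r ^ M k)) * (r ^ M k) ^ l) \<longlongrightarrow> 1) (at 0)"
    "((\<lambda>r. ?U (r ^ M k) * (r ^ M k) ^ l) \<longlongrightarrow> - sign_const l) (at 0)"
    by (rule filterlim_compose[OF K_univ_limit_infinity filterlim_power_at_0[OF Mk]])
       (rule filterlim_compose[OF K_univ_limit_zero filterlim_power_at_0[OF Mk]])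
  have Mj: "0 < M j" "M k \<noteq> M j" if "j \<in> S - {k}" for j
  proof -
    show "0 < M j" using assms that unfolding decreasing_on_def by blast
    have "k < j \<or> j < k" using that by auto
    moreover have "j < k \<Longrightarrow> M k < M j" "k < j \<Longrightarrow> M j < M k"
      using that assms(2,3) unfolding decreasing_on_def by blast+
    ultimately show "M k \<noteq> M j" by auto
  qed
  have P: "((\<lambda>r. \<Prod>j\<in>S - {k}. pair_factor (inverse r ^ M k) (inverse r ^ M j)) \<longlongrightarrow>
       (\<Prod>j\<in>S - {k}. if M k < M j then t else 1)) (at 0)"
    "((\<lambda>r. \<Prod>j\<in>S - {k}. pair_factor (r ^ M k) (inverse r ^ M j)) \<longlongrightarrow>
       (\<Prod>j\<in>S - {k}. if M k < M j then t else t\<^sup>2)) (at 0)"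
    by (intro tendsto_prod pair_factor_limit Mk Mj; assumption)+
  have "((\<lambda>r. (?U (inverse (r ^ M k)) * (r ^ M k) ^ l) *
               (\<Prod>j\<in>S - {k}. pair_factor (inverse r ^ M k) (inverse r ^ M j)) +
              (?U (r ^ M k) * (r ^ M k) ^ l) *
               (\<Prod>j\<in>S - {k}. pair_factor (r ^ M k) (inverse r ^ M j))) \<longlongrightarrow>
      1 * (\<Prod>j\<in>S - {k}. if M k < M j then t else 1) +
      - sign_const l * (\<Prod>j\<in>S - {k}. if M k < M j then t else t\<^sup>2)) (at 0)"
    by (intro tendsto_add tendsto_mult U P)
  moreover have "1 * (\<Prod>j\<in>S - {k}. if M k < M j then t else 1) +
      - sign_const l * (\<Prod>j\<in>S - {k}. if M k < M j then t else t\<^sup>2) =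
      t ^ rank_in S k * (1 - sign_const l * t ^ (2 * (card S - 1 - rank_in S k)))"
    by (simp only: prod_if_rank[OF assms] power_mult power_one mult_1_left mult_1_right
          right_diff_distrib) (simp only: mult_ac diff_conv_add_uminus mult_minus_left mult_minus_right)
  moreover have "sign_sum l k (S - {k}) (curve M r) * r ^ (l * M k) =
      (?U (inverse (r ^ M k)) * (r ^ M k) ^ l) *
               (\<Prod>j\<in>S - {k}. pair_factor (inverse r ^ M k) (inverse r ^ M j)) +
              (?U (r ^ M k) * (r ^ M k) ^ l) *
               (\<Prod>j\<in>S - {k}. pair_factor (r ^ M k) (inverse r ^ M j))" for r
  proof -
    have "r ^ (l * M k) = (r ^ M k) ^ l" by (simp only: power_mult mult.commute[of l])
    moreover have "curve M r k powi 1 = inverse (r ^ M k)" "curve M r k powi -1 = r ^ M k"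
      by (simp_all add: curve_def power_inverse)
    moreover have "inverse (r ^ M k) = inverse r ^ M k" by (simp add: power_inverse)
    ultimately show ?thesis
      unfolding sign_sum_def by (simp add: curve_def distrib_left mult.assoc mult.commute mult.left_commute)
  qed
  ultimately show ?thesis by simp
qed

text \<open>
  One step sums over the position \<open>i\<close> of the variable that is removed first; only positions inside
  the block of parts equal to the first part attain the maximal exponent.
\<close>

primrec lead_coef :: "nat list \<Rightarrow> complex" where
  "lead_coef [] = 1"
| "lead_coef (l # ls) = (\<Sum>i\<le>length ls. if \<forall>j\<le>i. (l # ls) ! j = l
      then t ^ i * (1 - sign_const l * t ^ (2 * (length ls - i))) else 0) * lead_coef ls"

text \<open>
  In each step the scaled summand splits into the limits of \<open>sign_sum\<close>, of the remaining sum, and of a power of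
  \<open>r\<close> that is constant or tends to \<open>0\<close> according to \<open>weight_remove\<close>.
\<close>

theorem peel_sum_limit:
  assumes "finite S" "card S = length ls" "decreasing_on S M" "sorted_wrt (\<ge>) ls"
  shows "((\<lambda>r. peel_sum ls S (curve M r) * r ^ weight ls S M) \<longlongrightarrow> lead_coef ls) (at 0)"
  using assms
proof (induction ls arbitrary: S)
  case Nil
  then show ?case by simp
next
  case (Cons l ls)
  have "\<forall>k\<in>S. \<exists>gap. weight (l # ls) S M = l * M k + weight ls (S - {k}) M + gap \<and>
           (gap = 0 \<longleftrightarrow> (\<forall>i\<le>rank_in S k. (l # ls) ! i = l))"
    using weight_remove[of S ls _ M l] Cons.prems by auto
  from bchoice[OF this] obtain gap where
    gap: "\<And>k. k \<in> S \<Longrightarrow> weight (l # ls) S M = l * M k + weight ls (S - {k}) M + gap k"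
    and gap0: "\<And>k. k \<in> S \<Longrightarrow> gap k = 0 \<longleftrightarrow> (\<forall>i\<le>rank_in S k. (l # ls) ! i = l)"
    by blast
  let ?c = "\<lambda>i. t ^ i * (1 - sign_const l * t ^ (2 * (card S - 1 - i)))"
  have "((\<lambda>r. \<Sum>k\<in>S. (sign_sum l k (S - {k}) (curve M r) * r ^ (l * M k)) *
          (peel_sum ls (S - {k}) (curve M r) * r ^ weight ls (S - {k}) M) * r ^ gap k) \<longlongrightarrow>
        (\<Sum>k\<in>S. ?c (rank_in S k) * lead_coef ls * (if gap k = 0 then 1 else 0))) (at 0)"
  proof (rule tendsto_sum)
    fix k assume k: "k \<in> S"
    have sub: "decreasing_on (S - {k}) M" using Cons.prems(3) by (rule decreasing_on_subset) auto
    have IH: "((\<lambda>r. peel_sum ls (S - {k}) (curve M r) * r ^ weight ls (S - {k}) M) \<longlongrightarrow> lead_coef ls) (at 0)"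
      using Cons.prems(1,2,4) k by (intro Cons.IH sub) simp_all
    show "((\<lambda>r. (sign_sum l k (S - {k}) (curve M r) * r ^ (l * M k)) *
          (peel_sum ls (S - {k}) (curve M r) * r ^ weight ls (S - {k}) M) * r ^ gap k) \<longlongrightarrow>
        ?c (rank_in S k) * lead_coef ls * (if gap k = 0 then 1 else 0)) (at 0)"
      by (rule tendsto_mult[OF tendsto_mult[OF sign_sum_limit[OF Cons.prems(1) k Cons.prems(3)] IH]
            tendsto_power_indicator])
  qed
  moreover have "(\<Sum>k\<in>S. (sign_sum l k (S - {k}) (curve M r) * r ^ (l * M k)) *
          (peel_sum ls (S - {k}) (curve M r) * r ^ weight ls (S - {k}) M) * r ^ gap k) =
      peel_sum (l # ls) S (curve M r) * r ^ weight (l # ls) S M" for r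
    unfolding peel_sum.simps sum_distrib_right
    by (intro sum.cong refl) (simp only: gap power_add mult_ac)
  moreover have "(\<Sum>k\<in>S. ?c (rank_in S k) * lead_coef ls * (if gap k = 0 then 1 else 0)) = lead_coef (l # ls)"
  proof -
    let ?g = "\<lambda>i. if \<forall>j\<le>i. (l # ls) ! j = l then ?c i else 0"
    have "(\<Sum>k\<in>S. ?c (rank_in S k) * lead_coef ls * (if gap k = 0 then 1 else 0)) =
          (\<Sum>k\<in>S. ?g (rank_in S k)) * lead_coef ls"
      unfolding sum_distrib_right
    proof (rule sum.cong[OF refl])
      fix k assume k: "k \<in> S"
      show "?c (rank_in S k) * lead_coef ls * (if gap k = 0 then 1 else 0) =
            ?g (rank_in S k) * lead_coef ls"
        unfolding gap0[OF k, symmetric] by (cases "gap k = 0") simp_all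
    qed
    also have "(\<Sum>k\<in>S. ?g (rank_in S k)) = (\<Sum>i<card S. ?g i)"
      by (rule sum_rank_in) (use Cons.prems in auto)
    finally show ?thesis
      by (simp only: Cons.prems(2) length_Cons diff_Suc_1 lessThan_Suc_atMost lead_coef.simps)
  qed
  ultimately show ?case by (simp only:)
qed

end

section \<open>Expansion in symmetric Laurent monomials\<close>

text \<open>
  Laurent polynomials are compared at generic points only, since the symmetric functions of the
  coordinates \<open>x\<^sub>i\<close> are expressed through the set of their values and need these to be distinct.
\<close>

inductive_set laurent_poly :: "nat \<Rightarrow> ((nat \<Rightarrow> complex) \<Rightarrow> complex) set" for n where
  lp_monom: "(\<lambda>z. c * laurent_monom n \<alpha> z) \<in> laurent_poly n"
| lp_add: "f \<in> laurent_poly n \<Longrightarrow> g \<in> laurent_poly n \<Longrightarrow> (\<lambda>z. f z + g z) \<in> laurent_poly n"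
| lp_cong: "f \<in> laurent_poly n \<Longrightarrow> (\<And>z. z \<in> generic_points n \<Longrightarrow> g z = f z) \<Longrightarrow> g \<in> laurent_poly n"

lemma laurent_monom_mult:
  assumes "z \<in> generic_points n"
  shows "laurent_monom n \<alpha> z * laurent_monom n \<beta> z = laurent_monom n (\<lambda>i. \<alpha> i + \<beta> i) z"
  unfolding laurent_monom_def prod.distrib[symmetric]
  using assms by (intro prod.cong refl) (simp add: power_int_add generic_points_def)

lemma lp_mult:
  assumes "f \<in> laurent_poly n" "g \<in> laurent_poly n"
  shows "(\<lambda>z. f z * g z) \<in> laurent_poly n"
  using assms(1)
proof induction
  case (lp_monom c \<alpha>)
  show ?case using assms(2)
  proof induction
    case (lp_monom d \<beta>)
    show ?case
      by (rule lp_cong[OF laurent_poly.lp_monom[where c = "c * d" and \<alpha> = "\<lambda>i. \<alpha> i + \<beta> i"]])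
         (simp add: laurent_monom_mult[symmetric])
  next
    case (lp_add g h)
    from laurent_poly.lp_add[OF lp_add.IH] show ?case by (simp add: distrib_left)
  next
    case (lp_cong g h)
    show ?case by (rule laurent_poly.lp_cong[OF lp_cong.IH]) (simp add: lp_cong.hyps)
  qed
next
  case (lp_add f h)
  from laurent_poly.lp_add[OF lp_add.IH] show ?case by (simp add: distrib_right)
next
  case (lp_cong f h)
  show ?case by (rule laurent_poly.lp_cong[OF lp_cong.IH]) (simp add: lp_cong.hyps)
qed

lemma lp_const: "(\<lambda>z. c) \<in> laurent_poly n"
  by (rule lp_cong[OF lp_monom[where c = c and \<alpha> = "\<lambda>i. 0"]]) (simp add: laurent_monom_def)

lemma lp_diff:
  assumes "f \<in> laurent_poly n" "g \<in> laurent_poly n"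
  shows "(\<lambda>z. f z - g z) \<in> laurent_poly n"
  using lp_add[OF assms(1) lp_mult[OF lp_const[of "-1"] assms(2)]] by simp

lemma lp_coordinate:
  assumes "i \<in> {1..n}"
  shows "(\<lambda>z. z i powi e) \<in> laurent_poly n"
proof (rule lp_cong[OF lp_monom[where c = 1 and \<alpha> = "\<lambda>j. if j = i then e else 0"]])
  fix z :: "nat \<Rightarrow> complex"
  have "laurent_monom n (\<lambda>j. if j = i then e else 0) z = (\<Prod>j\<in>{1..n}. if j = i then z i powi e else 1)"
    unfolding laurent_monom_def by (intro prod.cong refl) auto
  then show "z i powi e = 1 * laurent_monom n (\<lambda>j. if j = i then e else 0) z"
    using assms by (simp add: prod.delta)
qed

lemma lp_jouk: "i \<in> {1..n} \<Longrightarrow> (\<lambda>z. jouk z i) \<in> laurent_poly n"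
  using lp_add[OF lp_coordinate[of i n 1] lp_coordinate[of i n "-1"]] by (simp add: jouk_def)

lemma jouk_image_remove:
  assumes "z \<in> generic_points n" "S \<subseteq> {1..n}" "i \<in> S"
  shows "jouk z ` (S - {i}) = jouk z ` S - {jouk z i}"
  using jouk_inj[of "{1..n}" z] assms unfolding generic_points_iff inj_on_def by blast

lemma lp_elem_coeff:
  assumes "S \<subseteq> {1..n}"
  shows "(\<lambda>z. elem_coeff r (jouk z ` S)) \<in> laurent_poly n"
proof -
  have "finite S" using assms finite_subset by blast
  then show ?thesis using assms
  proof (induction S arbitrary: r)
    case empty
    show ?case by (simp add: lp_const)
  next
    case (insert i S)
    have rem: "jouk z ` S = jouk z ` insert i S - {jouk z i}" if "z \<in> generic_points n" for z
      using jouk_image_remove[OF that insert.prems, of i] insert.hyps by simp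
    show ?case
    proof (cases r)
      case 0
      show ?thesis unfolding 0
        by (rule lp_cong[OF lp_const[of 1]])
           (simp add: elem_coeff_def poly_0_coeff_0[symmetric] poly_prod)
    next
      case (Suc q)
      have "(\<lambda>z. elem_coeff (Suc q) (jouk z ` S) - jouk z i * elem_coeff q (jouk z ` S)) \<in> laurent_poly n"
        using insert by (intro lp_diff lp_mult lp_jouk) auto
      then show ?thesis unfolding Suc
      proof (rule lp_cong)
        fix z assume z: "z \<in> generic_points n"
        have "elem_coeff (Suc q) (jouk z ` insert i S - {jouk z i}) =
            elem_coeff (Suc q) (jouk z ` insert i S) + jouk z i * elem_coeff q (jouk z ` insert i S - {jouk z i})"
          using insert.hyps by (intro elem_coeff_remove) auto
        then show "elem_coeff (Suc q) (jouk z ` insert i S) =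
            elem_coeff (Suc q) (jouk z ` S) - jouk z i * elem_coeff q (jouk z ` S)"
          unfolding rem[OF z] by simp
      qed
    qed
  qed
qed

text \<open>
  For two elements \<open>a \<noteq> b\<close>, removing either of them shows that \<open>a - b\<close> times the sum is a
  difference of the same sums for two sets of equal size, which vanishes by induction.
\<close>

lemma divided_power_0:
  assumes "finite X"
  shows "divided_power 0 X = (if card X = 1 then 1 else 0)"
  using assms
proof (induction "card X" arbitrary: X rule: less_induct)
  case less
  consider "X = {}" | a where "X = {a}" | a b where "a \<in> X" "b \<in> X" "a \<noteq> b" by blast
  then show ?case
  proof cases
    case 3
    have "card X > 0" using less.prems 3 card_gt_0_iff by blast
    then have "divided_power 0 (X - {a}) = divided_power 0 (X - {b})"
      using less 3 by (simp add: card_Diff_singleton)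
    then have "(a - b) * divided_power 0 X = 0"
      using divided_power_remove[OF less.prems 3(1), of 0] divided_power_remove[OF less.prems 3(2), of 0]
      by (simp add: left_diff_distrib)
    moreover have "card X \<noteq> 1" using 3 by (auto simp: card_1_singleton_iff)
    ultimately show ?thesis using 3 by simp
  qed (simp_all add: divided_power_def)
qed

text \<open>
  The recursion \<open>h\<^sub>d\<^sub>+\<^sub>1(X) = h\<^sub>d(X - {y}) + y h\<^sub>d(X)\<close> replaces the quotients by polynomial operations.
\<close>

lemma lp_divided_power:
  assumes "S \<subseteq> {1..n}"
  shows "(\<lambda>z. divided_power d (jouk z ` S)) \<in> laurent_poly n"
proof -
  have "finite S" using assms finite_subset by blast
  then show ?thesis using assms
  proof (induction S arbitrary: d)
    case empty
    show ?case by (simp add: lp_const)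
  next
    case (insert i S)
    note IHS = insert.IH
    have sub: "S \<subseteq> {1..n}" "i \<in> {1..n}" using insert.prems by auto
    have rem: "jouk z ` S = jouk z ` insert i S - {jouk z i}" if "z \<in> generic_points n" for z
      using jouk_image_remove[OF that insert.prems, of i] insert.hyps by simp
    show ?case
    proof (induction d)
      case 0
      show ?case
      proof (rule lp_cong[OF lp_const[of "if card (insert i S) = 1 then 1 else 0"]])
        fix z assume "z \<in> generic_points n"
        then have "inj_on (jouk z) (insert i S)"
          using jouk_inj[of "{1..n}" z] insert.prems inj_on_subset unfolding generic_points_iff by blast
        then have "card (jouk z ` insert i S) = card (insert i S)" by (rule card_image)
        then show "divided_power 0 (jouk z ` insert i S) = (if card (insert i S) = 1 then 1 else 0)"
          using insert.hyps by (subst divided_power_0) auto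
      qed
    next
      case (Suc d)
      have "(\<lambda>z. divided_power d (jouk z ` S) + jouk z i * divided_power d (jouk z ` insert i S)) \<in> laurent_poly n"
        by (intro lp_add lp_mult lp_jouk IHS sub Suc)
      then show ?case
      proof (rule lp_cong)
        fix z assume z: "z \<in> generic_points n"
        have "divided_power d (jouk z ` insert i S - {jouk z i}) =
            divided_power (Suc d) (jouk z ` insert i S) - jouk z i * divided_power d (jouk z ` insert i S)"
          using insert.hyps by (intro divided_power_remove) auto
        then show "divided_power (Suc d) (jouk z ` insert i S) =
            divided_power d (jouk z ` S) + jouk z i * divided_power d (jouk z ` insert i S)"
          unfolding rem[OF z] by simp
      qed
    qed
  qed
qed

lemma symfun_laurent_poly: "f \<in> symfun \<Longrightarrow> (\<lambda>z. f (jouk z ` {1..n})) \<in> laurent_poly n"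
proof (induction rule: symfun.induct)
  case (symfun_cong f g)
  show ?case by (rule lp_cong[OF symfun_cong.IH]) (simp add: symfun_cong.hyps)
qed (auto intro: lp_const lp_elem_coeff lp_divided_power lp_add lp_mult)

text \<open>
  The product in the hyperoctahedral group for which \<open>act_exponent\<close> is a left action; the sign vector is
  restricted so that the product lies in the representing set.
\<close>

definition signed_perm_mult ::
  "nat \<Rightarrow> (nat \<Rightarrow> nat) \<times> (nat \<Rightarrow> int) \<Rightarrow> (nat \<Rightarrow> nat) \<times> (nat \<Rightarrow> int) \<Rightarrow> (nat \<Rightarrow> nat) \<times> (nat \<Rightarrow> int)" where
  "signed_perm_mult n v w =
     (fst v \<circ> fst w, \<lambda>i\<in>{1..n}. snd v (fst w i) * snd w i)"

lemma hyperoctahedralD: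
  assumes "w \<in> hyperoctahedral n"
  shows "fst w permutes {1..n}" "snd w \<in> {1..n} \<rightarrow>\<^sub>E {1, -1}"
    "\<And>i. i \<in> {1..n} \<Longrightarrow> snd w i = 1 \<or> snd w i = -1"
  using assms by (auto simp: hyperoctahedral_def PiE_iff)

lemma hyperoctahedralI:
  "\<rho> permutes {1..n} \<Longrightarrow> \<epsilon> \<in> {1..n} \<rightarrow>\<^sub>E {1, -1} \<Longrightarrow> (\<rho>, \<epsilon>) \<in> hyperoctahedral n"
  by (simp add: hyperoctahedral_def)

lemma signed_perm_mult_closed:
  assumes v: "v \<in> hyperoctahedral n" and w: "w \<in> hyperoctahedral n"
  shows "signed_perm_mult n v w \<in> hyperoctahedral n"
  unfolding signed_perm_mult_def
proof (rule hyperoctahedralI)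
  show "fst v \<circ> fst w permutes {1..n}"
    by (rule permutes_compose[OF hyperoctahedralD(1)[OF w] hyperoctahedralD(1)[OF v]])
  show "(\<lambda>i\<in>{1..n}. snd v (fst w i) * snd w i) \<in> {1..n} \<rightarrow>\<^sub>E {1, -1}"
  proof (rule restrict_PiE_iff[THEN iffD2], rule ballI)
    fix i assume i: "i \<in> {1..n}"
    then have "fst w i \<in> {1..n}" using permutes_in_image[OF hyperoctahedralD(1)[OF w]] by blast
    then show "snd v (fst w i) * snd w i \<in> {1, -1}"
      using hyperoctahedralD(3)[OF v] hyperoctahedralD(3)[OF w i] by fastforce
  qed
qed

lemma act_exponent_image:
  assumes w: "w \<in> hyperoctahedral n" and i: "i \<in> {1..n}"
  shows "act_exponent n w \<alpha> (fst w i) = snd w i * \<alpha> i"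
  using permutes_in_image[OF hyperoctahedralD(1)[OF w]] i
    permutes_inverses(2)[OF hyperoctahedralD(1)[OF w]]
  unfolding act_exponent_def by simp

lemma act_exponent_eqI:
  assumes w: "w \<in> hyperoctahedral n"
    and "\<And>i. i \<in> {1..n} \<Longrightarrow> \<beta> (fst w i) = snd w i * \<alpha> i" and "\<And>j. j \<notin> {1..n} \<Longrightarrow> \<beta> j = 0"
  shows "act_exponent n w \<alpha> = \<beta>"
proof
  fix j
  show "act_exponent n w \<alpha> j = \<beta> j"
  proof (cases "j \<in> {1..n}")
    case True
    then obtain i where i: "i \<in> {1..n}" "j = fst w i"
      using permutes_image[OF hyperoctahedralD(1)[OF w]] by blast
    then show ?thesis using act_exponent_image[OF w i(1)] assms(2) by simp
  next
    case False
    then show ?thesis using assms(3)[OF False] by (simp only: act_exponent_def if_False)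
  qed
qed

lemma act_exponent_mult:
  assumes v: "v \<in> hyperoctahedral n" and w: "w \<in> hyperoctahedral n"
  shows "act_exponent n (signed_perm_mult n v w) \<alpha> = act_exponent n v (act_exponent n w \<alpha>)"
proof (rule act_exponent_eqI[OF signed_perm_mult_closed[OF v w]])
  fix i assume i: "i \<in> {1..n}"
  then have "fst w i \<in> {1..n}" using permutes_in_image[OF hyperoctahedralD(1)[OF w]] by blast
  then show "act_exponent n v (act_exponent n w \<alpha>) (fst (signed_perm_mult n v w) i) =
      snd (signed_perm_mult n v w) i * \<alpha> i"
    using i by (simp add: signed_perm_mult_def act_exponent_image[OF v] act_exponent_image[OF w])
qed (simp only: act_exponent_def if_False)

lemma bij_signed_perm_mult:
  assumes w: "w \<in> hyperoctahedral n"
  shows "bij_betw (\<lambda>v. signed_perm_mult n v w) (hyperoctahedral n) (hyperoctahedral n)"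
proof -
  let ?f = "\<lambda>v. signed_perm_mult n v w"
  note pw = hyperoctahedralD(1)[OF w]
  have "inj_on ?f (hyperoctahedral n)"
  proof (rule inj_onI)
    fix u v assume u: "u \<in> hyperoctahedral n" and v: "v \<in> hyperoctahedral n" and eq: "?f u = ?f v"
    have "fst u \<circ> fst w = fst v \<circ> fst w" using eq by (simp add: signed_perm_mult_def)
    then have "(fst u \<circ> fst w) \<circ> inv (fst w) = (fst v \<circ> fst w) \<circ> inv (fst w)" by simp
    then have 1: "fst u = fst v" by (simp add: o_assoc[symmetric] permutes_inv_o[OF pw])
    have 2: "snd u = snd v"
    proof (rule PiE_ext[OF hyperoctahedralD(2)[OF u] hyperoctahedralD(2)[OF v]])
      fix j assume "j \<in> {1..n}"
      then obtain i where i: "i \<in> {1..n}" "j = fst w i" using permutes_image[OF pw] by blast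
      have "snd (?f u) i = snd (?f v) i" using eq by simp
      then have "snd u j * snd w i = snd v j * snd w i" using i by (simp add: signed_perm_mult_def)
      then show "snd u j = snd v j" using hyperoctahedralD(3)[OF w i(1)] by auto
    qed
    show "u = v" using 1 2 by (rule prod_eqI)
  qed
  moreover have "?f ` hyperoctahedral n \<subseteq> hyperoctahedral n"
    using signed_perm_mult_closed[OF _ w] by blast
  ultimately show ?thesis
    using endo_inj_surj[OF finite_hyperoctahedral] by (simp add: bij_betw_def)
qed

definition orbit_exponents :: "nat \<Rightarrow> (nat \<Rightarrow> nat) \<Rightarrow> (nat \<Rightarrow> int) set" where
  "orbit_exponents n mu = (\<lambda>w. act_exponent n w (\<lambda>i. int (mu i))) ` hyperoctahedral n"

lemma monom_sym_BC_orbit: "monom_sym_BC n mu z = (\<Sum>\<beta>\<in>orbit_exponents n mu. laurent_monom n \<beta> z)"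
  by (simp add: monom_sym_BC_def orbit_exponents_def)

lemma finite_orbit_exponents: "finite (orbit_exponents n mu)"
  unfolding orbit_exponents_def by (intro finite_imageI finite_hyperoctahedral)

lemma identity_in_hyperoctahedral: "(id, \<lambda>i\<in>{1..n}. 1) \<in> hyperoctahedral n"
  by (rule hyperoctahedralI) (auto simp: permutes_id)

lemma monom_sym_BC_invariant:
  assumes v: "v \<in> hyperoctahedral n"
  shows "monom_sym_BC n mu (act_point v z) = monom_sym_BC n mu z"
proof -
  let ?O = "orbit_exponents n mu"
  have inj: "inj_on (act_exponent n v) ?O"
  proof (rule inj_onI)
    fix \<alpha> \<beta> assume *: "\<alpha> \<in> ?O" "\<beta> \<in> ?O" "act_exponent n v \<alpha> = act_exponent n v \<beta>"
    show "\<alpha> = \<beta>"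
    proof
      fix i
      show "\<alpha> i = \<beta> i"
      proof (cases "i \<in> {1..n}")
        case True
        have "snd v i * \<alpha> i = snd v i * \<beta> i"
          by (simp only: act_exponent_image[OF v True, symmetric] *(3))
        then show ?thesis using hyperoctahedralD(3)[OF v True] by auto
      next
        case False
        then show ?thesis using * by (auto simp: orbit_exponents_def act_exponent_def)
      qed
    qed
  qed
  have sub: "act_exponent n v ` ?O \<subseteq> ?O"
  proof
    fix \<beta> assume "\<beta> \<in> act_exponent n v ` ?O"
    then obtain w where w: "w \<in> hyperoctahedral n"
      "\<beta> = act_exponent n v (act_exponent n w (\<lambda>i. int (mu i)))"
      unfolding orbit_exponents_def by blast
    then have "\<beta> = act_exponent n (signed_perm_mult n v w) (\<lambda>i. int (mu i))"
      by (simp only: act_exponent_mult[OF v w(1)])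
    then show "\<beta> \<in> ?O"
      unfolding orbit_exponents_def using signed_perm_mult_closed[OF v w(1)] by blast
  qed
  have bij: "bij_betw (act_exponent n v) ?O ?O"
    using endo_inj_surj[OF finite_orbit_exponents sub inj] inj by (simp add: bij_betw_def)
  have "monom_sym_BC n mu (act_point v z) = (\<Sum>\<beta>\<in>?O. laurent_monom n (act_exponent n v \<beta>) z)"
    unfolding monom_sym_BC_orbit act_fun_laurent_monom[OF v, symmetric] by (simp add: act_fun_def)
  also have "\<dots> = monom_sym_BC n mu z"
    unfolding monom_sym_BC_orbit by (rule sum.reindex_bij_betw[OF bij])
  finally show ?thesis .
qed

text \<open>
  Right multiplication by \<open>w\<close> shows that the sum is the same for every exponent in the orbit of \<open>\<mu>\<close>.
  Summing over the orbit and using the invariance of \<open>m\<^sub>\<mu>\<close> determines the constant.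
\<close>

lemma group_sum_laurent_monom:
  assumes w: "w \<in> hyperoctahedral n"
  shows "(\<Sum>v\<in>hyperoctahedral n. laurent_monom n (act_exponent n w (\<lambda>i. int (mu i))) (act_point v z)) =
    of_nat (card (hyperoctahedral n)) / of_nat (card (orbit_exponents n mu)) * monom_sym_BC n mu z"
proof -
  let ?W = "hyperoctahedral n" and ?O = "orbit_exponents n mu" and ?mu = "\<lambda>i. int (mu i)"
  define G where "G = (\<Sum>v\<in>?W. laurent_monom n (act_exponent n v ?mu) z)"
  have G: "(\<Sum>v\<in>?W. laurent_monom n (act_exponent n w ?mu) (act_point v z)) = G"
    if w: "w \<in> ?W" for w
  proof -
    have "(\<Sum>v\<in>?W. laurent_monom n (act_exponent n w ?mu) (act_point v z)) =
          (\<Sum>v\<in>?W. laurent_monom n (act_exponent n (signed_perm_mult n v w) ?mu) z)"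
    proof (intro sum.cong refl)
      fix v assume v: "v \<in> ?W"
      show "laurent_monom n (act_exponent n w ?mu) (act_point v z) =
          laurent_monom n (act_exponent n (signed_perm_mult n v w) ?mu) z"
        unfolding act_exponent_mult[OF v w] act_fun_laurent_monom[OF v, symmetric] act_fun_def ..
    qed
    also have "\<dots> = G"
      unfolding G_def by (rule sum.reindex_bij_betw[OF bij_signed_perm_mult[OF w]])
    finally show ?thesis .
  qed
  have "of_nat (card ?W) * monom_sym_BC n mu z = (\<Sum>v\<in>?W. monom_sym_BC n mu (act_point v z))"
    by (simp add: monom_sym_BC_invariant)
  also have "\<dots> = (\<Sum>\<beta>\<in>?O. \<Sum>v\<in>?W. laurent_monom n \<beta> (act_point v z))"
    unfolding monom_sym_BC_orbit by (rule sum.swap)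
  also have "\<dots> = (\<Sum>\<beta>\<in>?O. G)"
  proof (rule sum.cong[OF refl])
    fix \<beta> assume "\<beta> \<in> ?O"
    then obtain u where "u \<in> ?W" "\<beta> = act_exponent n u ?mu" unfolding orbit_exponents_def by blast
    then show "(\<Sum>v\<in>?W. laurent_monom n \<beta> (act_point v z)) = G" using G by simp
  qed
  also have "\<dots> = of_nat (card ?O) * G" by simp
  finally have "of_nat (card ?W) * monom_sym_BC n mu z = of_nat (card ?O) * G" .
  moreover have "card ?O \<noteq> 0"
    using finite_orbit_exponents identity_in_hyperoctahedral[of n] unfolding orbit_exponents_def by auto
  ultimately have "G = of_nat (card ?W) / of_nat (card ?O) * monom_sym_BC n mu z"
    by (simp add: field_simps)
  then show ?thesis using G[OF w] by simp
qed

text \<open>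
  Sorting the absolute values of the exponents gives the partition; the signs are restored by the sign
  vector.
\<close>

lemma exponent_sort:
  "\<exists>w\<in>hyperoctahedral n. \<exists>mu\<in>partitions_upto n. \<forall>i\<in>{1..n}. \<alpha> i = act_exponent n w (\<lambda>i. int (mu i)) i"
proof -
  define f where "f i = nat \<bar>\<alpha> i\<bar>" for i
  define xs where "xs = rev (sort (map f [1..<Suc n]))"
  have len: "length xs = n" by (simp add: xs_def)
  define mu where "mu i = (if i \<in> {1..n} then xs ! (i - 1) else 0)" for i
  have sorted: "sorted (rev xs)" by (simp add: xs_def)
  have desc: "xs ! j \<le> xs ! i" if "i \<le> j" "j < n" for i j
    by (rule sorted_rev_nth_mono[OF sorted that(1)]) (simp add: len that(2))
  have mu: "mu \<in> partitions_upto n"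
    unfolding partitions_upto_def
  proof (intro CollectI conjI ballI allI impI)
    fix i j assume "i \<in> {1..n}" "j \<in> {1..n}" "i \<le> j"
    then have "xs ! (j - 1) \<le> xs ! (i - 1)" by (intro desc) auto
    then show "mu j \<le> mu i"
      using \<open>i \<in> {1..n}\<close> \<open>j \<in> {1..n}\<close> by (simp only: mu_def if_True)
  qed (simp only: mu_def if_False)
  have "map mu [1..<Suc n] = xs"
  proof (rule nth_equalityI)
    fix i assume "i < length (map mu [1..<Suc n])"
    then have "i < n" by (simp del: upt_Suc)
    then show "map mu [1..<Suc n] ! i = xs ! i"
      by (simp add: mu_def nth_map_upt del: upt_Suc)
  qed (simp add: len)
  then have "mset (map mu [1..<Suc n]) = mset (map f [1..<Suc n])" by (simp add: xs_def del: upt_Suc)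
  moreover have "mset_set {1..n} = mset [1..<Suc n]"
    by (simp only: mset_upt atLeastLessThanSuc_atLeastAtMost)
  ultimately have "image_mset mu (mset_set {1..n}) = image_mset f (mset_set {1..n})"
    by (simp only: mset_map)
  then obtain p where p: "p permutes {1..n}" "\<forall>i\<in>{1..n}. mu i = f (p i)"
    by (rule image_mset_eq_implies_permutes[OF finite_atLeastAtMost])
  define w where "w = (p, \<lambda>i\<in>{1..n}. if \<alpha> (p i) \<ge> 0 then 1 else (-1::int))"
  have w: "w \<in> hyperoctahedral n"
    unfolding w_def by (rule hyperoctahedralI[OF p(1)]) auto
  have "\<alpha> j = act_exponent n w (\<lambda>i. int (mu i)) j" if "j \<in> {1..n}" for j
  proof -
    have "j \<in> p ` {1..n}" using that permutes_image[OF p(1)] by simp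
    then obtain i where i: "j = p i" "i \<in> {1..n}" by (rule imageE)
    have "mu i = nat \<bar>\<alpha> (p i)\<bar>" using bspec[OF p(2) i(2)] by (simp only: f_def)
    moreover have "snd w i = (if \<alpha> (p i) \<ge> 0 then 1 else -1)"
      using i(2) by (simp only: w_def snd_conv restrict_apply if_True)
    ultimately have "snd w i * int (mu i) = \<alpha> (p i)" by (cases "\<alpha> (p i) \<ge> 0") simp_all
    moreover have "act_exponent n w (\<lambda>i. int (mu i)) (p i) = snd w i * int (mu i)"
      using act_exponent_image[OF w i(2)] unfolding w_def fst_conv .
    ultimately show ?thesis unfolding i(1) by metis
  qed
  then show ?thesis by (intro bexI[OF _ w] bexI[OF _ mu] ballI)
qed

lemma act_point_generic:
  assumes z: "z \<in> generic_points n" and w: "w \<in> hyperoctahedral n"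
  shows "act_point w z \<in> generic_points n"
proof -
  have p: "fst w i \<in> {1..n}" if "i \<in> {1..n}" for i
    using permutes_in_image[OF hyperoctahedralD(1)[OF w]] that by blast
  have val: "act_point w z i = z (fst w i) \<or> act_point w z i = inverse (z (fst w i))"
    if "i \<in> {1..n}" for i
    using hyperoctahedralD(3)[OF w that] by (auto simp: act_point_def)
  have one: "z i \<noteq> 0 \<and> z i ^ 2 \<noteq> 1" if "i \<in> {1..n}" for i
    using z that unfolding generic_points_def by blast
  have two: "z i \<noteq> z j \<and> z i * z j \<noteq> 1" if "i \<in> {1..n}" "j \<in> {1..n}" "i \<noteq> j" for i j
    using z that unfolding generic_points_def by blast
  have inv_sq: "inverse x ^ 2 \<noteq> 1" if "x ^ 2 \<noteq> 1" for x :: complex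
    using that by (simp add: power_inverse)
  have inv2: "inverse x \<noteq> y \<and> inverse x * y \<noteq> 1" if "x \<noteq> 0" "y \<noteq> 0" "x \<noteq> y" "x * y \<noteq> 1" for x y :: complex
    using that by (auto simp: field_simps)
  have inv1: "x \<noteq> inverse y \<and> x * inverse y \<noteq> 1" if "x \<noteq> 0" "y \<noteq> 0" "x \<noteq> y" "x * y \<noteq> 1" for x y :: complex
    using that by (auto simp: field_simps)
  have inv3: "inverse x * inverse y \<noteq> 1" if "x * y \<noteq> 1" for x y :: complex
    using that by (simp add: inverse_mult_distrib[symmetric] del: inverse_mult_distrib)
  show ?thesis
    unfolding generic_points_def
  proof (intro CollectI conjI ballI impI)
    fix i assume i: "i \<in> {1..n}"
    show "act_point w z i \<noteq> 0" using val[OF i] one[OF p[OF i]] by auto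
    show "act_point w z i ^ 2 \<noteq> 1" using val[OF i] one[OF p[OF i]] inv_sq[of "z (fst w i)"]
      by (elim disjE) (simp_all only: simp_thms)
    fix j assume j: "j \<in> {1..n}" and ij: "i \<noteq> j"
    have "fst w i \<noteq> fst w j" using ij permutes_inj[OF hyperoctahedralD(1)[OF w]] by (auto simp: inj_def)
    note facts = one[OF p[OF i]] one[OF p[OF j]] two[OF p[OF i] p[OF j] this]
    show "act_point w z i \<noteq> act_point w z j"
      using val[OF i] val[OF j] facts inv1[of "z (fst w i)" "z (fst w j)"]
        inv2[of "z (fst w i)" "z (fst w j)"] inverse_inverse_eq
      by (elim disjE) auto
    show "act_point w z i * act_point w z j \<noteq> 1"
      using val[OF i] val[OF j] facts inv1[of "z (fst w i)" "z (fst w j)"]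
        inv2[of "z (fst w i)" "z (fst w j)"] inv3[of "z (fst w i)" "z (fst w j)"]
      by (elim disjE) (simp_all only: simp_thms)
  qed
qed

lemma jouk_act_point_image:
  assumes w: "w \<in> hyperoctahedral n"
  shows "jouk (act_point w z) ` {1..n} = jouk z ` {1..n}"
proof -
  have "jouk (act_point w z) i = jouk z (fst w i)" if "i \<in> {1..n}" for i
    using hyperoctahedralD(3)[OF w that] by (auto simp: jouk_def act_point_def)
  then have "jouk (act_point w z) ` {1..n} = jouk z ` fst w ` {1..n}" by (force simp: image_def)
  then show ?thesis using permutes_image[OF hyperoctahedralD(1)[OF w]] by simp
qed

lemma group_sum_laurent_poly:
  assumes "f \<in> laurent_poly n"
  shows "\<exists>P d. finite P \<and> P \<subseteq> partitions_upto n \<and>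
    (\<forall>z\<in>generic_points n. (\<Sum>v\<in>hyperoctahedral n. f (act_point v z)) = (\<Sum>mu\<in>P. d mu * monom_sym_BC n mu z))"
  using assms
proof induction
  case (lp_monom c \<alpha>)
  obtain w mu where w: "w \<in> hyperoctahedral n" and mu: "mu \<in> partitions_upto n"
    and \<alpha>: "\<forall>i\<in>{1..n}. \<alpha> i = act_exponent n w (\<lambda>i. int (mu i)) i"
    using exponent_sort by blast
  have "laurent_monom n \<alpha> z = laurent_monom n (act_exponent n w (\<lambda>i. int (mu i))) z" for z
    unfolding laurent_monom_def by (intro prod.cong refl) (use \<alpha> in auto)
  then have "(\<Sum>v\<in>hyperoctahedral n. c * laurent_monom n \<alpha> (act_point v z)) =
     (\<Sum>nu\<in>{mu}. (c * (of_nat (card (hyperoctahedral n)) / of_nat (card (orbit_exponents n mu)))) *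
        monom_sym_BC n nu z)" for z
    by (simp add: sum_distrib_left[symmetric] group_sum_laurent_monom[OF w])
  with mu show ?case
    by (intro exI[of _ "{mu}"]
        exI[of _ "\<lambda>nu. c * (of_nat (card (hyperoctahedral n)) / of_nat (card (orbit_exponents n mu)))"]
        conjI ballI) auto
next
  case (lp_add f g)
  obtain P1 d1 where 1: "finite P1" "P1 \<subseteq> partitions_upto n" "\<And>z. z \<in> generic_points n \<Longrightarrow>
     (\<Sum>v\<in>hyperoctahedral n. f (act_point v z)) = (\<Sum>mu\<in>P1. d1 mu * monom_sym_BC n mu z)"
    using lp_add.IH(1) by blast
  obtain P2 d2 where 2: "finite P2" "P2 \<subseteq> partitions_upto n" "\<And>z. z \<in> generic_points n \<Longrightarrow>
     (\<Sum>v\<in>hyperoctahedral n. g (act_point v z)) = (\<Sum>mu\<in>P2. d2 mu * monom_sym_BC n mu z)"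
    using lp_add.IH(2) by blast
  define d where "d mu = (if mu \<in> P1 then d1 mu else 0) + (if mu \<in> P2 then d2 mu else 0)" for mu
  have "(\<Sum>v\<in>hyperoctahedral n. f (act_point v z) + g (act_point v z)) =
      (\<Sum>mu\<in>P1 \<union> P2. d mu * monom_sym_BC n mu z)" if z: "z \<in> generic_points n" for z
  proof -
    have ext: "(\<Sum>mu\<in>P. e mu * monom_sym_BC n mu z) =
        (\<Sum>mu\<in>P1 \<union> P2. (if mu \<in> P then e mu else 0) * monom_sym_BC n mu z)"
      if "P \<subseteq> P1 \<union> P2" for P e
      using that 1(1) 2(1) by (intro sum.mono_neutral_cong_left) auto
    show ?thesis
      unfolding sum.distrib 1(3)[OF z] 2(3)[OF z] d_def distrib_right
      by (simp only: ext[OF Un_upper1] ext[OF Un_upper2])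
  qed
  then show ?case using 1 2 by (intro exI[of _ "P1 \<union> P2"] exI[of _ d]) auto
next
  case (lp_cong f g)
  have "(\<Sum>v\<in>hyperoctahedral n. g (act_point v z)) = (\<Sum>v\<in>hyperoctahedral n. f (act_point v z))"
    if "z \<in> generic_points n" for z
    by (intro sum.cong refl lp_cong.hyps(2) act_point_generic that)
  then show ?case using lp_cong.IH by simp
qed

text \<open>
  A symmetric function of the \<open>x\<^sub>i\<close> is invariant under the group, hence equal to its own average, and
  the average of a Laurent monomial is a multiple of some \<open>m\<^sub>\<mu>\<close>.
\<close>

theorem symfun_monom_expansion:
  assumes "f \<in> symfun"
  shows "\<exists>P d. finite P \<and> P \<subseteq> partitions_upto n \<and>
    (\<forall>z\<in>generic_points n. f (jouk z ` {1..n}) = (\<Sum>mu\<in>P. d mu * monom_sym_BC n mu z))"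
proof -
  obtain P d where P: "finite P" "P \<subseteq> partitions_upto n" "\<And>z. z \<in> generic_points n \<Longrightarrow>
     (\<Sum>v\<in>hyperoctahedral n. f (jouk (act_point v z) ` {1..n})) = (\<Sum>mu\<in>P. d mu * monom_sym_BC n mu z)"
    using group_sum_laurent_poly[OF symfun_laurent_poly[OF assms, of n]] by blast
  let ?N = "of_nat (card (hyperoctahedral n)) :: complex"
  have "card (hyperoctahedral n) \<noteq> 0"
    using finite_hyperoctahedral identity_in_hyperoctahedral[of n] by auto
  then have N: "?N \<noteq> 0" by simp
  have "f (jouk z ` {1..n}) = (\<Sum>mu\<in>P. (d mu / ?N) * monom_sym_BC n mu z)"
    if z: "z \<in> generic_points n" for z
  proof -
    have "?N * f (jouk z ` {1..n}) = (\<Sum>mu\<in>P. d mu * monom_sym_BC n mu z)"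
    proof -
      have "(\<Sum>v\<in>hyperoctahedral n. f (jouk (act_point v z) ` {1..n})) =
          (\<Sum>v\<in>hyperoctahedral n. f (jouk z ` {1..n}))"
        by (intro sum.cong refl) (simp only: jouk_act_point_image)
      then show ?thesis using P(3)[OF z] by (simp only: sum_constant)
    qed
    then have "f (jouk z ` {1..n}) = (\<Sum>mu\<in>P. d mu * monom_sym_BC n mu z) / ?N"
      using N by (metis nonzero_mult_div_cancel_left)
    then show ?thesis by (simp add: sum_divide_distrib)
  qed
  then show ?thesis using P(1,2) by (intro exI[of _ P] exI[of _ "\<lambda>mu. d mu / ?N"]) blast
qed

section \<open>The normalising factor\<close>

lemma sorted_prefix_count:
  assumes "sorted_wrt (\<ge>) ls" "\<forall>x\<in>set ls. x \<le> (l::nat)" "i < length ls"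
  shows "(\<forall>j\<le>i. ls ! j = l) \<longleftrightarrow> i < count_list ls l"
  using assms
proof (induction ls arbitrary: i)
  case Nil
  then show ?case by simp
next
  case (Cons x xs)
  show ?case
  proof (cases "x = l")
    case True
    show ?thesis
    proof (cases i)
      case 0
      then show ?thesis using True by simp
    next
      case (Suc i')
      have "(\<forall>j\<le>i'. xs ! j = l) \<longleftrightarrow> i' < count_list xs l"
        using Cons.prems Suc by (intro Cons.IH) auto
      moreover have "(\<forall>j\<le>Suc i'. (x # xs) ! j = l) \<longleftrightarrow> (\<forall>j\<le>i'. xs ! j = l)"
        using All_less_Suc2[of "Suc i'" "\<lambda>j. (x # xs) ! j = l"] True
        by (simp only: less_Suc_eq_le nth_Cons_0 nth_Cons_Suc simp_thms)
      ultimately show ?thesis using True Suc by simp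
    qed
  next
    case False
    then have "l \<notin> set (x # xs)" using Cons.prems by fastforce
    then have "count_list (x # xs) l = 0" by (rule count_notin)
    moreover have "(x # xs) ! 0 \<noteq> l" using False by simp
    ultimately show ?thesis by (metis le0 less_nat_zero_code)
  qed
qed

lemma count_list_01: "\<forall>x\<in>set ls. x \<le> (1::nat) \<Longrightarrow> length ls = count_list ls 0 + count_list ls 1"
proof (induction ls)
  case (Cons x xs)
  then have "x = 0 \<or> x = 1" by auto
  then show ?case using Cons by auto
qed simp

definition q_factorial :: "complex \<Rightarrow> nat \<Rightarrow> complex" where
  "q_factorial t m = (\<Prod>j=1..m. (1 - t ^ j) / (1 - t))"

lemma q_factorial_Suc: "q_factorial t (Suc m) = q_factorial t m * ((1 - t ^ Suc m) / (1 - t))"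
  by (simp add: q_factorial_def)

lemma prod_q_factorial_Cons:
  "(\<Prod>i\<in>set (l # ls). q_factorial t (count_list (l # ls) i)) =
     (1 - t ^ Suc (count_list ls l)) / (1 - t) * (\<Prod>i\<in>set ls. q_factorial t (count_list ls i))"
proof -
  let ?R = "\<Prod>i\<in>set ls - {l}. q_factorial t (count_list ls i)"
  have "(\<Prod>i\<in>set (l # ls). q_factorial t (count_list (l # ls) i)) =
      q_factorial t (count_list (l # ls) l) * (\<Prod>i\<in>set (l # ls) - {l}. q_factorial t (count_list (l # ls) i))"
    by (rule prod.remove) auto
  also have "(\<Prod>i\<in>set (l # ls) - {l}. q_factorial t (count_list (l # ls) i)) = ?R"
    by (rule prod.cong) auto
  finally have 1: "(\<Prod>i\<in>set (l # ls). q_factorial t (count_list (l # ls) i)) =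
      q_factorial t (Suc (count_list ls l)) * ?R" by simp
  have 2: "(\<Prod>i\<in>set ls. q_factorial t (count_list ls i)) = q_factorial t (count_list ls l) * ?R"
  proof (cases "l \<in> set ls")
    case True
    then show ?thesis by (simp add: prod.remove)
  next
    case False
    then have "count_list ls l = 0" "set ls - {l} = set ls" by auto
    then show ?thesis by (simp add: q_factorial_def)
  qed
  show ?thesis unfolding 1 2 q_factorial_Suc by simp
qed

lemma count_list_map_upt: "count_list (map lam [1..<Suc n]) i = mult_part n lam i"
proof -
  have "count_list (map lam [1..<Suc n]) i = length (filter (\<lambda>j. i = lam j) [1..<Suc n])"
    by (simp add: count_list_eq_length_filter filter_map o_def del: upt_Suc)
  also have "\<dots> = card ({j. i = lam j} \<inter> set [1..<Suc n])"
    by (rule distinct_length_filter) simp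
  also have "{j. i = lam j} \<inter> set [1..<Suc n] = {j\<in>{1..n}. lam j = i}"
    by (auto simp del: upt_Suc)
  finally show ?thesis by (simp only: mult_part_def)
qed

lemma partition_list_sorted:
  assumes "lam \<in> partitions_upto n"
  shows "sorted_wrt (\<ge>) (map lam [1..<Suc n])"
  unfolding sorted_wrt_map
proof (rule sorted_wrt_mono_rel[OF _ sorted_wrt_upt])
  fix x y assume "x \<in> set [1..<Suc n]" "y \<in> set [1..<Suc n]" "x < y"
  then have "x \<in> {1..n}" "y \<in> {1..n}" "x \<le> y" by auto
  then show "lam x \<ge> lam y" using assms unfolding partitions_upto_def by blast
qed

context koornwinder
begin

definition K_norm_list :: "nat list \<Rightarrow> complex" where
  "K_norm_list ls = (\<Prod>i\<in>set ls. q_factorial t (count_list ls i)) *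
     (\<Prod>i=1..count_list ls 1. 1 - t0 * t1 * t2 * t3 * t ^ (i - 1 + 2 * count_list ls 0)) *
     (\<Prod>i=1..count_list ls 0. 1 - a * b * t ^ (i - 1))"

lemma K_norm_eq_list: "K_norm n lam t a b t0 t1 t2 t3 = K_norm_list (map lam [1..<Suc n])"
proof -
  have "set (map lam [1..<Suc n]) = lam ` {1..n}"
    by (simp only: set_map set_upt atLeastLessThanSuc_atLeastAtMost)
  then show ?thesis
    by (simp only: K_norm_def K_norm_list_def count_list_map_upt q_factorial_def)
qed

text \<open>
  With \<open>m = k + 1\<close> parts equal to \<open>l\<close> and \<open>N\<close> further parts after the first, the positions
  \<open>i \<le> k\<close> contribute \<open>t\<^sup>i - e t\<^bsup>2N-i\<^esup>\<close>, and \<open>t\<^bsup>2N-i\<^esup> = t\<^bsup>2N-k\<^esup> t\<^bsup>k-i\<^esup>\<close> lets the geometric sum factor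
  out.
\<close>

lemma lead_coef_Cons:
  assumes "t \<noteq> 1" "sorted_wrt (\<ge>) (l # ls)"
  shows "lead_coef (l # ls) = (1 - t ^ Suc (count_list ls l)) / (1 - t) *
     (1 - sign_const l * t ^ (2 * length ls - count_list ls l)) * lead_coef ls"
proof -
  let ?k = "count_list ls l" and ?N = "length ls"
  have k: "?k \<le> ?N" by (rule count_le_length)
  have idx: "(\<forall>j\<le>i. (l # ls) ! j = l) \<longleftrightarrow> i < Suc ?k" if "i \<le> ?N" for i
    using sorted_prefix_count[OF assms(2), of l i] assms(2) that by simp
  have "(\<Sum>i\<le>?N. if \<forall>j\<le>i. (l # ls) ! j = l
      then t ^ i * (1 - sign_const l * t ^ (2 * (?N - i))) else 0) =
    (\<Sum>i\<le>?N. if i < Suc ?k then t ^ i * (1 - sign_const l * t ^ (2 * (?N - i))) else 0)"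
    by (rule sum.cong[OF refl]) (simp only: idx atMost_iff)
  also have "\<dots> = (\<Sum>i<Suc ?k. t ^ i * (1 - sign_const l * t ^ (2 * (?N - i))))"
    using k by (intro sum.mono_neutral_cong_right) auto
  also have "\<dots> = (\<Sum>i<Suc ?k. t ^ i) - sign_const l * t ^ (2 * ?N - ?k) * (\<Sum>i<Suc ?k. t ^ (Suc ?k - Suc i))"
  proof -
    have "t ^ i * (1 - sign_const l * t ^ (2 * (?N - i))) =
          t ^ i - sign_const l * t ^ (2 * ?N - ?k) * t ^ (Suc ?k - Suc i)" if "i < Suc ?k" for i
    proof -
      have "i + 2 * (?N - i) = (2 * ?N - ?k) + (Suc ?k - Suc i)" using that k by simp
      then have "t ^ i * t ^ (2 * (?N - i)) = t ^ (2 * ?N - ?k) * t ^ (Suc ?k - Suc i)"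
        by (simp only: power_add[symmetric])
      then have "t ^ i * (sign_const l * t ^ (2 * (?N - i))) =
          sign_const l * t ^ (2 * ?N - ?k) * t ^ (Suc ?k - Suc i)"
        by (metis mult.assoc mult.left_commute)
      then show ?thesis by (simp only: right_diff_distrib mult_1_right)
    qed
    then have "(\<Sum>i<Suc ?k. t ^ i * (1 - sign_const l * t ^ (2 * (?N - i)))) =
        (\<Sum>i<Suc ?k. t ^ i - sign_const l * t ^ (2 * ?N - ?k) * t ^ (Suc ?k - Suc i))"
      by (intro sum.cong refl) (simp only: lessThan_iff)
    then show ?thesis by (simp only: sum_subtractf sum_distrib_left)
  qed
  also have "(\<Sum>i<Suc ?k. t ^ (Suc ?k - Suc i)) = (\<Sum>i<Suc ?k. t ^ i)"
    by (rule sum.nat_diff_reindex)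
  also have "(\<Sum>i<Suc ?k. t ^ i) = (1 - t ^ Suc ?k) / (1 - t)"
    by (rule sum_gp_strict[THEN trans]) (simp add: assms(1))
  finally show ?thesis
    by (simp only: lead_coef.simps right_diff_distrib mult_1_right mult_1_left mult.commute)
qed

text \<open>
  The exponent \<open>2N - k\<close> of the new factor is \<open>m\<^sub>0 - 1\<close> for a part \<open>0\<close>, because then all parts vanish, and
  \<open>m\<^sub>1 - 1 + 2 m\<^sub>0\<close> for a part \<open>1\<close>, because then the remaining parts are \<open>0\<close> or \<open>1\<close>.
\<close>

lemma lead_coef_eq_K_norm_list:
  assumes "t \<noteq> 1" "sorted_wrt (\<ge>) ls"
  shows "lead_coef ls = K_norm_list ls"
  using assms(2)
proof (induction ls)
  case Nil
  show ?case by (simp add: K_norm_list_def)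
next
  case (Cons l ls)
  let ?k = "count_list ls l"
  let ?A = "\<lambda>ls. \<Prod>i=1..count_list ls 1. 1 - t0 * t1 * t2 * t3 * t ^ (i - 1 + 2 * count_list ls 0)"
  let ?B = "\<lambda>ls. \<Prod>i=1..count_list ls 0. 1 - a * b * t ^ (i - 1)"
  have IH: "lead_coef ls = K_norm_list ls" using Cons by simp
  have "(1 - sign_const l * t ^ (2 * length ls - ?k)) * (?A ls * ?B ls) = ?A (l # ls) * ?B (l # ls)"
  proof -
    consider "l = 0" | "l = 1" | "l \<ge> 2" by linarith
    then show ?thesis
    proof cases
      case 1
      then have z: "\<forall>x\<in>set ls. x = 0" using Cons.prems by simp
      then have c1: "count_list ls 1 = 0" by (auto simp: count_list_0_iff)
      have "length ls = count_list ls 0 + count_list ls 1"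
        by (rule count_list_01) (use z in \<open>auto simp: le_Suc_eq\<close>)
      then have "2 * length ls - ?k = count_list ls 0" using c1 1 by simp
      then show ?thesis using c1 1 by (simp add: sign_const_def)
    next
      case 2
      have "length ls = count_list ls 0 + count_list ls 1"
        by (rule count_list_01) (use Cons.prems 2 in simp)
      then have "2 * length ls - ?k = count_list ls 1 + 2 * count_list ls 0" using 2 by simp
      then show ?thesis using 2 by (simp add: sign_const_def)
    next
      case 3
      then show ?thesis by (simp add: sign_const_def)
    qed
  qed
  then show ?case
    unfolding lead_coef_Cons[OF assms(1) Cons.prems] IH K_norm_list_def prod_q_factorial_Cons
    by (simp only: mult.assoc mult.left_commute)
qed

lemma K_norm_eq_lead_coef:
  assumes "t \<noteq> 1" "lam \<in> partitions_upto n"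
  shows "lead_coef (map lam [1..<Suc n]) = K_norm n lam t a b t0 t1 t2 t3"
  unfolding K_norm_eq_list
  by (rule lead_coef_eq_K_norm_list[OF assms(1) partition_list_sorted[OF assms(2)]])

lemma K_norm_nonzero:
  assumes "norm t < 1" "norm a < 1" "norm b < 1" "norm t0 < 1" "norm t1 < 1" "norm t2 < 1" "norm t3 < 1"
  shows "K_norm n lam t a b t0 t1 t2 t3 \<noteq> 0"
proof -
  have mult_lt: "norm (x * y) < 1" if "norm x < 1" "norm y < 1" for x y :: complex
    using mult_strict_mono'[OF that] by (simp add: norm_mult)
  have pow_le: "norm (t ^ k) \<le> 1" for k
    using assms(1) by (simp add: norm_power power_le_one)
  have nz: "1 - x * t ^ k \<noteq> 0" if "norm x < 1" for x k
  proof
    assume "1 - x * t ^ k = 0"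
    then have "x * t ^ k = 1" by simp
    moreover have "norm (x * t ^ k) \<le> norm x * 1"
      unfolding norm_mult by (intro mult_left_mono pow_le) simp
    ultimately show False using that by simp
  qed
  have "1 - t ^ j \<noteq> 0" if "j \<ge> 1" for j
    using nz[OF assms(1), of "j - 1"] that by (simp add: power_eq_if)
  moreover have "1 - t \<noteq> 0" using assms(1) by auto
  ultimately have "(1 - t ^ j) / (1 - t) \<noteq> 0" if "j \<ge> 1" for j using that by simp
  moreover have "norm (a * b) < 1" "norm (t0 * t1 * t2 * t3) < 1"
    by (intro mult_lt assms)+
  ultimately show ?thesis
    unfolding K_norm_def mult_eq_0_iff de_Morgan_disj
    using nz by (intro conjI; subst prod_zero_iff; fastforce simp: prod_zero_iff)
qed

end

section \<open>Dominance from growth rates\<close>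

definition pairing :: "nat \<Rightarrow> (nat \<Rightarrow> nat) \<Rightarrow> (nat \<Rightarrow> nat) \<Rightarrow> nat" where
  "pairing n M mu = (\<Sum>i=1..n. mu i * M i)"

lemma weight_map_upt: "weight (map mu [k..<Suc n]) {k..n} M = (\<Sum>i=k..n. mu i * M i)"
proof (induction "Suc n - k" arbitrary: k)
  case 0
  then show ?case by simp
next
  case (Suc d)
  then have k: "k \<le> n" by simp
  have u: "[k..<Suc n] = k # [Suc k..<Suc n]" using k by (simp add: upt_conv_Cons del: upt_Suc)
  have "Min {k..n} = k" using k by (intro Min_eqI) auto
  moreover have "{k..n} - {k} = {Suc k..n}" by auto
  moreover have "weight (map mu [Suc k..<Suc n]) {Suc k..n} M = (\<Sum>i=Suc k..n. mu i * M i)"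
    using Suc by (intro Suc.hyps(1)) simp
  ultimately show ?case
    unfolding u by (simp add: sum.atLeast_Suc_atMost[OF k] del: upt_Suc)
qed

lemma sum_le_initial_sum:
  fixes mu :: "nat \<Rightarrow> nat"
  assumes "mu \<in> partitions_upto n" "A \<subseteq> {1..n}"
  shows "(\<Sum>i\<in>A. mu i) \<le> (\<Sum>i=1..card A. mu i)"
proof -
  have "finite A" using assms(2) finite_subset by blast
  then show ?thesis using assms(2)
  proof (induction A rule: finite_linorder_max_induct)
    case (insert m A)
    have "A \<subseteq> {1..m - 1}" using insert.hyps insert.prems by force
    then have "card A \<le> card {1..m - 1}" by (intro card_mono) auto
    then have c: "Suc (card A) \<le> m" using insert.prems by auto
    then have "mu m \<le> mu (Suc (card A))"
      using assms(1) insert.prems unfolding partitions_upto_def by auto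
    moreover have "m \<notin> A" using insert.hyps by blast
    ultimately show ?case using insert by simp
  qed simp
qed

lemma orbit_partial_sums:
  assumes mu: "mu \<in> partitions_upto n" and \<beta>: "\<beta> \<in> orbit_exponents n mu" and k: "k \<le> n"
  shows "(\<Sum>i=1..k. \<beta> i) \<le> (\<Sum>i=1..k. int (mu i))"
proof -
  obtain w where w: "w \<in> hyperoctahedral n" "\<beta> = act_exponent n w (\<lambda>i. int (mu i))"
    using \<beta> unfolding orbit_exponents_def by blast
  note p = hyperoctahedralD(1)[OF w(1)]
  let ?q = "inv (fst w)"
  have q: "?q permutes {1..n}" by (rule permutes_inv[OF p])
  have "\<beta> i \<le> int (mu (?q i))" if "i \<in> {1..k}" for i
  proof -
    have i: "i \<in> {1..n}" using that k by auto
    then have "?q i \<in> {1..n}" using permutes_in_image[OF q] by blast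
    then have "snd w (?q i) = 1 \<or> snd w (?q i) = -1" by (rule hyperoctahedralD(3)[OF w(1)])
    moreover have "\<beta> i = snd w (?q i) * int (mu (?q i))"
      unfolding w(2) act_exponent_def using i by (simp only: if_True)
    ultimately show ?thesis by auto
  qed
  then have "(\<Sum>i=1..k. \<beta> i) \<le> (\<Sum>i=1..k. int (mu (?q i)))" by (rule sum_mono)
  also have "\<dots> = int (\<Sum>i\<in>?q ` {1..k}. mu i)"
    by (simp add: sum.reindex[OF permutes_inj_on[OF q]])
  also have "\<dots> \<le> int (\<Sum>i=1..card (?q ` {1..k}). mu i)"
  proof -
    have "?q ` {1..k} \<subseteq> ?q ` {1..n}" using k by (intro image_mono) auto
    then have "?q ` {1..k} \<subseteq> {1..n}" by (simp only: permutes_image[OF q])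
    then show ?thesis using sum_le_initial_sum[OF mu] by (simp only: of_nat_le_iff)
  qed
  also have "card (?q ` {1..k}) = k" by (simp add: card_image[OF permutes_inj_on[OF q]])
  finally show ?thesis by simp
qed

lemma abel_summation:
  fixes M \<delta> :: "nat \<Rightarrow> int"
  shows "(\<Sum>i=1..n. M i * \<delta> i) =
    (\<Sum>k=1..n. (M k - M (Suc k)) * (\<Sum>i=1..k. \<delta> i)) + M (Suc n) * (\<Sum>i=1..n. \<delta> i)"
  by (induction n) (simp_all add: algebra_simps)

text \<open>
  Summation by parts reduces the claim to the partial sums, which are largest for the partition itself.
  The decreasing positive weights make every difference in a partial sum count strictly.
\<close>

lemma pairing_orbit_less:
  assumes mu: "mu \<in> partitions_upto n" and \<beta>: "\<beta> \<in> orbit_exponents n mu" "\<beta> \<noteq> (\<lambda>i. int (mu i))"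
    and M: "decreasing_on {1..n} M"
  shows "(\<Sum>i=1..n. int (M i) * \<beta> i) < int (pairing n M mu)"
proof -
  \<comment> \<open>Extending the weights by zero at \<open>n + 1\<close> removes the boundary term of the summation by parts.\<close>
  define M' where "M' i = (if i \<le> n then int (M i) else 0)" for i
  define \<delta> where "\<delta> i = int (mu i) - \<beta> i" for i
  define \<Delta> where "\<Delta> k = (\<Sum>i=1..k. \<delta> i)" for k
  have nonneg: "0 \<le> \<Delta> k" if "k \<in> {1..n}" for k
    using orbit_partial_sums[OF mu \<beta>(1), of k] that by (simp add: \<Delta>_def \<delta>_def sum_subtractf)
  have step: "0 < M' k - M' (Suc k)" if "k \<in> {1..n}" for k
  proof (cases "k = n")
    case True
    then show ?thesis using M that by (simp add: M'_def decreasing_on_def)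
  next
    case False
    then have "Suc k \<in> {1..n}" using that by auto
    then have "M (Suc k) < M k" using M that unfolding decreasing_on_def by blast
    then show ?thesis using that False by (simp add: M'_def)
  qed
  have "int (pairing n M mu) - (\<Sum>i=1..n. int (M i) * \<beta> i) = (\<Sum>i=1..n. M' i * \<delta> i)"
    unfolding pairing_def of_nat_sum sum_subtractf[symmetric]
  proof (intro sum.cong refl)
    fix i assume "i \<in> {1..n}"
    then have "M' i = int (M i)" by (simp add: M'_def)
    then show "int (mu i * M i) - int (M i) * \<beta> i = M' i * \<delta> i"
      by (simp only: \<delta>_def right_diff_distrib of_nat_mult mult.commute[of "int (mu i)"])
  qed
  also have "\<dots> = (\<Sum>k=1..n. (M' k - M' (Suc k)) * \<Delta> k)"
  proof -
    have "M' (Suc n) = 0" by (simp add: M'_def)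
    then show ?thesis
      unfolding abel_summation[of M' \<delta> n] \<Delta>_def by (simp only: mult_zero_left add_0_right)
  qed
  finally have eq: "int (pairing n M mu) - (\<Sum>i=1..n. int (M i) * \<beta> i) =
      (\<Sum>k=1..n. (M' k - M' (Suc k)) * \<Delta> k)" .
  have terms: "0 \<le> (M' k - M' (Suc k)) * \<Delta> k" if "k \<in> {1..n}" for k
    by (rule mult_nonneg_nonneg[OF less_imp_le[OF step[OF that]] nonneg[OF that]])
  have "(\<Sum>k=1..n. (M' k - M' (Suc k)) * \<Delta> k) \<noteq> 0"
  proof
    assume "(\<Sum>k=1..n. (M' k - M' (Suc k)) * \<Delta> k) = 0"
    moreover have "(\<Sum>k=1..n. (M' k - M' (Suc k)) * \<Delta> k) = 0 \<longleftrightarrow>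
        (\<forall>k\<in>{1..n}. (M' k - M' (Suc k)) * \<Delta> k = 0)"
      by (rule sum_nonneg_eq_0_iff[OF finite_atLeastAtMost]) (rule terms)
    ultimately have "\<forall>k\<in>{1..n}. (M' k - M' (Suc k)) * \<Delta> k = 0" by (rule iffD1[rotated])
    then have prod: "(M' k - M' (Suc k)) * \<Delta> k = 0" if "k \<in> {1..n}" for k
      using that by (rule bspec)
    have zero: "\<Delta> k = 0" if "k \<in> {1..n}" for k
    proof -
      have "M' k - M' (Suc k) \<noteq> 0" using step[OF that] by (rule less_imp_neq[symmetric])
      then show ?thesis using prod[OF that] by (simp only: mult_eq_0_iff simp_thms)
    qed
    have "\<beta> i = int (mu i)" for i
    proof (cases "i \<in> {1..n}")
      case True
      then obtain j where j: "i = Suc j" by (cases i) auto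
      have "\<Delta> j = 0"
        using zero[of j] True j by (cases "j = 0") (auto simp: \<Delta>_def)
      moreover have "\<Delta> i = \<Delta> j + \<delta> i" unfolding j \<Delta>_def by simp
      ultimately show ?thesis using zero[OF True] by (simp add: \<delta>_def)
    next
      case False
      then have "mu i = 0" using mu unfolding partitions_upto_def by blast
      moreover have "\<beta> i = 0"
        using \<beta>(1) False unfolding orbit_exponents_def act_exponent_def by auto
      ultimately show ?thesis by simp
    qed
    then show False using \<beta>(2) by blast
  qed
  moreover have "0 \<le> (\<Sum>k=1..n. (M' k - M' (Suc k)) * \<Delta> k)" by (rule sum_nonneg) (rule terms)
  ultimately show ?thesis using eq by linarith
qed

lemma partition_in_orbit:
  assumes "mu \<in> partitions_upto n"
  shows "(\<lambda>i. int (mu i)) \<in> orbit_exponents n mu"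
proof -
  have "act_exponent n (id, \<lambda>i\<in>{1..n}. 1) (\<lambda>i. int (mu i)) = (\<lambda>i. int (mu i))"
    by (rule act_exponent_eqI[OF identity_in_hyperoctahedral]) (use assms in \<open>auto simp: partitions_upto_def\<close>)
  then show ?thesis unfolding orbit_exponents_def using identity_in_hyperoctahedral by (metis image_eqI)
qed

lemma laurent_monom_curve:
  assumes "r \<noteq> 0"
  shows "laurent_monom n \<beta> (curve M r) = r powi (- (\<Sum>i=1..n. int (M i) * \<beta> i))"
proof -
  have "curve M r i powi \<beta> i = r powi (- (int (M i) * \<beta> i))" for i
    by (simp only: curve_def power_int_power power_int_inverse power_int_minus)
  then have "laurent_monom n \<beta> (curve M r) = (\<Prod>i=1..n. r powi (- (int (M i) * \<beta> i)))"
    by (simp add: laurent_monom_def)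
  also have "\<dots> = r powi (\<Sum>i=1..n. - (int (M i) * \<beta> i))"
  proof (induction n)
    case (Suc n)
    then show ?case using assms by (simp add: power_int_add flip: add_uminus_conv_diff)
  qed simp
  finally show ?thesis by (simp add: sum_negf)
qed

lemma monom_sym_BC_limit:
  assumes mu: "mu \<in> partitions_upto n" and M: "decreasing_on {1..n} M"
  shows "((\<lambda>r. monom_sym_BC n mu (curve M r) * r ^ pairing n M mu) \<longlongrightarrow> 1) (at 0)"
proof -
  let ?O = "orbit_exponents n mu" and ?mu = "\<lambda>i. int (mu i)"
  define gap where "gap \<beta> = nat (int (pairing n M mu) - (\<Sum>i=1..n. int (M i) * \<beta> i))" for \<beta>
  have top: "(\<Sum>i=1..n. int (M i) * ?mu i) = int (pairing n M mu)"
    by (simp add: pairing_def mult.commute)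
  have le: "(\<Sum>i=1..n. int (M i) * \<beta> i) \<le> int (pairing n M mu)" if "\<beta> \<in> ?O" for \<beta>
    using pairing_orbit_less[OF mu that _ M] top by (cases "\<beta> = ?mu") auto
  have gap0: "gap \<beta> = 0 \<longleftrightarrow> \<beta> = ?mu" if "\<beta> \<in> ?O" for \<beta>
    using pairing_orbit_less[OF mu that _ M] top by (cases "\<beta> = ?mu") (auto simp: gap_def)
  have "((\<lambda>r. \<Sum>\<beta>\<in>?O. r ^ gap \<beta>) \<longlongrightarrow> (\<Sum>\<beta>\<in>?O. if gap \<beta> = 0 then 1 else (0::complex))) (at 0)"
    by (intro tendsto_sum tendsto_power_indicator)
  moreover have "(\<Sum>\<beta>\<in>?O. if gap \<beta> = 0 then 1 else (0::complex)) = (\<Sum>\<beta>\<in>?O. if \<beta> = ?mu then 1 else 0)"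
    by (intro sum.cong refl) (simp only: gap0)
  moreover have "\<dots> = 1"
    using partition_in_orbit[OF mu] by (simp add: sum.delta[OF finite_orbit_exponents])
  ultimately have "((\<lambda>r. \<Sum>\<beta>\<in>?O. r ^ gap \<beta>) \<longlongrightarrow> (1::complex)) (at 0)" by (simp only:)
  moreover have "eventually (\<lambda>r. (\<Sum>\<beta>\<in>?O. r ^ gap \<beta>) =
      monom_sym_BC n mu (curve M r) * r ^ pairing n M mu) (at (0::complex))"
    unfolding eventually_at_filter
  proof (intro always_eventually allI impI)
    fix r :: complex assume r: "r \<noteq> 0"
    have "r ^ gap \<beta> = laurent_monom n \<beta> (curve M r) * r ^ pairing n M mu" if "\<beta> \<in> ?O" for \<beta>
    proof -
      let ?s = "\<Sum>i=1..n. int (M i) * \<beta> i"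
      have "r ^ gap \<beta> = r powi (int (pairing n M mu) - ?s)"
        using le[OF that] by (simp add: gap_def power_int_nonneg_exp)
      also have "\<dots> = r powi (- ?s) * r powi int (pairing n M mu)"
        using r power_int_add[of r "- ?s" "int (pairing n M mu)"] by (simp only: simp_thms uminus_add_conv_diff)
      finally show ?thesis by (simp add: laurent_monom_curve[OF r])
    qed
    then show "(\<Sum>\<beta>\<in>?O. r ^ gap \<beta>) = monom_sym_BC n mu (curve M r) * r ^ pairing n M mu"
      unfolding monom_sym_BC_orbit sum_distrib_right by (intro sum.cong refl)
  qed
  ultimately show ?thesis by (rule Lim_transform_eventually)
qed

text \<open>
  If every \<open>m \<mu>\<close> is asymptotic to \<open>r\<^bsup>-p \<mu>\<^esup>\<close> with distinct exponents, the term of largest exponent in a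
  combination cannot be cancelled, so the combination determines its order of growth and its leading coefficient.
\<close>

lemma leading_exponent:
  fixes m :: "'b \<Rightarrow> complex \<Rightarrow> complex" and p :: "'b \<Rightarrow> nat"
  assumes fin: "finite P" and inj: "inj_on p P"
    and m: "\<And>\<mu>. \<mu> \<in> P \<Longrightarrow> ((\<lambda>r. m \<mu> r * r ^ p \<mu>) \<longlongrightarrow> 1) (at 0)"
    and G: "((\<lambda>r. (\<Sum>\<mu>\<in>P. d \<mu> * m \<mu> r) * r ^ A) \<longlongrightarrow> v) (at 0)"
  shows "\<And>\<mu>. \<mu> \<in> P \<Longrightarrow> d \<mu> \<noteq> 0 \<Longrightarrow> p \<mu> \<le> A"
    and "(\<Sum>\<mu>\<in>P. if p \<mu> = A then d \<mu> else 0) = v"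
proof -
  define Q where "Q = {\<mu> \<in> P. d \<mu> \<noteq> 0}"
  have QP: "finite Q" "Q \<subseteq> P" using fin by (auto simp: Q_def)
  have sumQ: "(\<Sum>\<mu>\<in>P. d \<mu> * m \<mu> r) = (\<Sum>\<mu>\<in>Q. d \<mu> * m \<mu> r)" for r
    using fin by (intro sum.mono_neutral_right) (auto simp: Q_def)
  have lim: "((\<lambda>r. (\<Sum>\<mu>\<in>Q. d \<mu> * m \<mu> r) * r ^ E) \<longlongrightarrow> (\<Sum>\<mu>\<in>Q. if p \<mu> = E then d \<mu> else 0)) (at 0)"
    if E: "\<And>\<mu>. \<mu> \<in> Q \<Longrightarrow> p \<mu> \<le> E" for E
  proof -
    have "((\<lambda>r. \<Sum>\<mu>\<in>Q. d \<mu> * ((m \<mu> r * r ^ p \<mu>) * r ^ (E - p \<mu>))) \<longlongrightarrow>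
        (\<Sum>\<mu>\<in>Q. d \<mu> * (1 * (if E - p \<mu> = 0 then 1 else 0)))) (at 0)"
      using QP(2) by (intro tendsto_sum tendsto_mult_left tendsto_mult[OF m tendsto_power_indicator]) auto
    moreover have "(\<Sum>\<mu>\<in>Q. d \<mu> * (1 * (if E - p \<mu> = 0 then 1 else 0))) = (\<Sum>\<mu>\<in>Q. if p \<mu> = E then d \<mu> else 0)"
      by (intro sum.cong refl) (use E in \<open>auto simp: le_antisym\<close>)
    moreover have "(\<Sum>\<mu>\<in>Q. d \<mu> * ((m \<mu> r * r ^ p \<mu>) * r ^ (E - p \<mu>))) = (\<Sum>\<mu>\<in>Q. d \<mu> * m \<mu> r) * r ^ E" for r
      unfolding sum_distrib_right
    proof (intro sum.cong refl)
      fix \<mu> assume "\<mu> \<in> Q"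
      then have "r ^ E = r ^ p \<mu> * r ^ (E - p \<mu>)" using E by (simp add: power_add[symmetric])
      then show "d \<mu> * ((m \<mu> r * r ^ p \<mu>) * r ^ (E - p \<mu>)) = d \<mu> * m \<mu> r * r ^ E" by (simp only: mult.assoc)
    qed
    ultimately show ?thesis by (simp only:)
  qed
  have bound: "p \<mu> \<le> A" if "\<mu> \<in> Q" for \<mu>
  proof (rule ccontr)
    assume "\<not> p \<mu> \<le> A"
    \<comment> \<open>At the scale of the largest exponent \<open>E > A\<close>, the combination tends both to \<open>0\<close> and to a nonzero coefficient.\<close>
    define E where "E = Max (p ` Q)"
    have E: "p \<nu> \<le> E" if "\<nu> \<in> Q" for \<nu> unfolding E_def using QP(1) that by simp
    have "E \<in> p ` Q" unfolding E_def using QP(1) \<open>\<mu> \<in> Q\<close> by (intro Max_in) auto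
    then obtain \<nu> where \<nu>: "\<nu> \<in> Q" "p \<nu> = E" by auto
    have "A < E" using E[OF \<open>\<mu> \<in> Q\<close>] \<open>\<not> p \<mu> \<le> A\<close> by simp
    have "(\<Sum>\<mu>\<in>Q. if p \<mu> = E then d \<mu> else 0) = (\<Sum>\<mu>\<in>Q. if \<mu> = \<nu> then d \<nu> else 0)"
    proof (intro sum.cong refl)
      fix \<kappa> assume "\<kappa> \<in> Q"
      then have "p \<kappa> = E \<longleftrightarrow> \<kappa> = \<nu>" using inj QP(2) \<nu> by (auto simp: inj_on_def)
      then show "(if p \<kappa> = E then d \<kappa> else 0) = (if \<kappa> = \<nu> then d \<nu> else 0)" by simp
    qed
    also have "\<dots> = d \<nu>" using \<nu>(1) QP(1) by simp
    finally have "((\<lambda>r. (\<Sum>\<mu>\<in>Q. d \<mu> * m \<mu> r) * r ^ E) \<longlongrightarrow> d \<nu>) (at 0)"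
      using lim[of E] E by simp
    moreover have "((\<lambda>r. ((\<Sum>\<mu>\<in>Q. d \<mu> * m \<mu> r) * r ^ A) * r ^ (E - A)) \<longlongrightarrow> v * 0) (at 0)"
      using G \<open>A < E\<close> unfolding sumQ by (intro tendsto_mult tendsto_power_0) auto
    moreover have "((\<Sum>\<mu>\<in>Q. d \<mu> * m \<mu> r) * r ^ A) * r ^ (E - A) = (\<Sum>\<mu>\<in>Q. d \<mu> * m \<mu> r) * r ^ E" for r
      using \<open>A < E\<close> by (simp add: mult.assoc power_add[symmetric])
    ultimately have "d \<nu> = v * 0" by (intro tendsto_unique[OF at_neq_bot]) simp_all
    then show False using \<nu>(1) by (simp add: Q_def)
  qed
  then show "\<And>\<mu>. \<mu> \<in> P \<Longrightarrow> d \<mu> \<noteq> 0 \<Longrightarrow> p \<mu> \<le> A" by (simp add: Q_def)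
  have "(\<Sum>\<mu>\<in>P. if p \<mu> = A then d \<mu> else 0) = (\<Sum>\<mu>\<in>Q. if p \<mu> = A then d \<mu> else 0)"
    using fin by (intro sum.mono_neutral_right) (auto simp: Q_def)
  also have "\<dots> = v"
    using tendsto_unique[OF at_neq_bot lim[OF bound] G[unfolded sumQ]] by simp
  finally show "(\<Sum>\<mu>\<in>P. if p \<mu> = A then d \<mu> else 0) = v" .
qed

lemma curve_generic:
  assumes M: "decreasing_on {1..n} M" and r: "r \<noteq> 0" "norm r < 1"
  shows "curve M r \<in> generic_points n"
proof -
  have R: "1 < norm (inverse r)" using r by (simp add: norm_inverse one_less_inverse)
  have nrm: "norm (curve M r i) = norm (inverse r) ^ M i" for i
    by (simp add: curve_def norm_power norm_inverse)
  have big: "1 < norm (curve M r i)" if "i \<in> {1..n}" for i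
    unfolding nrm using R M that by (intro one_less_power) (auto simp: decreasing_on_def)
  have lt: "norm (curve M r j) < norm (curve M r i)" if "i \<in> {1..n}" "j \<in> {1..n}" "i < j" for i j
    unfolding nrm using R M that by (intro power_strict_increasing) (auto simp: decreasing_on_def)
  have mult: "x * y \<noteq> 1" if "1 < norm x" "1 < norm y" for x y :: complex
  proof
    assume "x * y = 1"
    then have "norm x * norm y = 1" by (simp add: norm_mult[symmetric])
    moreover have "1 < norm x * norm y" using that by (rule less_1_mult)
    ultimately show False by simp
  qed
  show ?thesis
    unfolding generic_points_def
  proof (intro CollectI conjI ballI impI)
    fix i assume i: "i \<in> {1..n}"
    show "curve M r i \<noteq> 0" using big[OF i] by auto
    show "curve M r i ^ 2 \<noteq> 1" unfolding power2_eq_square by (rule mult[OF big[OF i] big[OF i]])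
    fix j assume j: "j \<in> {1..n}" and ij: "i \<noteq> j"
    show "curve M r i \<noteq> curve M r j"
      using lt[OF i j] lt[OF j i] ij by (metis linorder_neqE_nat less_irrefl)
    show "curve M r i * curve M r j \<noteq> 1" by (rule mult[OF big[OF i] big[OF j]])
  qed
qed

lemma digit_sum:
  fixes mu nu :: "nat \<Rightarrow> nat"
  assumes mu: "\<forall>i. mu i < B"
  shows "(\<Sum>i=1..n. mu i * B ^ (n - i)) < B ^ n"
    and "\<forall>i. nu i < B \<Longrightarrow> (\<Sum>i=1..n. mu i * B ^ (n - i)) = (\<Sum>i=1..n. nu i * B ^ (n - i)) \<Longrightarrow>
      \<forall>i\<in>{1..n}. mu i = nu i"
proof -
  have horner: "(\<Sum>i=1..Suc n. f i * B ^ (Suc n - i)) = B * (\<Sum>i=1..n. f i * B ^ (n - i)) + f (Suc n)"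
    for f :: "nat \<Rightarrow> nat" and n
    unfolding sum_distrib_left by (simp add: Suc_diff_le mult_ac)
  show "(\<Sum>i=1..n. mu i * B ^ (n - i)) < B ^ n"
  proof (induction n)
    case (Suc n)
    have "B * (\<Sum>i=1..n. mu i * B ^ (n - i)) + mu (Suc n) < B * (\<Sum>i=1..n. mu i * B ^ (n - i)) + B"
      using mu by simp
    also have "\<dots> = B * Suc (\<Sum>i=1..n. mu i * B ^ (n - i))" by simp
    also have "\<dots> \<le> B * B ^ n" using Suc by (intro mult_left_mono) auto
    finally show ?case unfolding horner by simp
  qed simp
  assume nu: "\<forall>i. nu i < B"
  show "(\<Sum>i=1..n. mu i * B ^ (n - i)) = (\<Sum>i=1..n. nu i * B ^ (n - i)) \<Longrightarrow>
      \<forall>i\<in>{1..n}. mu i = nu i"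
  proof (induction n)
    case (Suc n)
    let ?m = "\<Sum>i=1..n. mu i * B ^ (n - i)" and ?n = "\<Sum>i=1..n. nu i * B ^ (n - i)"
    have eq: "B * ?m + mu (Suc n) = B * ?n + nu (Suc n)" using Suc.prems(1) unfolding horner .
    have "(B * ?m + mu (Suc n)) mod B = mu (Suc n)" "(B * ?n + nu (Suc n)) mod B = nu (Suc n)"
      using mu nu by simp_all
    then have last: "mu (Suc n) = nu (Suc n)" using eq by metis
    have "B > 0" using spec[OF mu, of 0] by simp
    then have "?m = ?n" using eq last by simp
    then have "\<forall>i\<in>{1..n}. mu i = nu i" by (rule Suc.IH)
    then show ?case using last by (auto simp: le_Suc_eq)
  qed simp
qed

text \<open>
  The first summand of \<open>M\<close> measures the \<open>k\<close>-th partial sum; the second reads a partition with entries less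
  than \<open>B\<close> as a number in base \<open>B\<close> and so separates different partitions without disturbing the first.
\<close>

lemma separating_weights:
  assumes k: "k \<in> {1..n}" and B: "2 \<le> B"
  defines "M \<equiv> \<lambda>i. (if i \<le> k then B ^ n else 0) + B ^ (n - i)"
  shows "decreasing_on {1..n} M"
    and "pairing n M mu = B ^ n * (\<Sum>i=1..k. mu i) + (\<Sum>i=1..n. mu i * B ^ (n - i))"
proof -
  show "decreasing_on {1..n} M"
    unfolding decreasing_on_def
  proof (intro conjI ballI impI)
    fix i assume "i \<in> {1..n}"
    show "0 < M i" using B by (simp add: M_def)
    fix j assume "j \<in> {1..n}" "i < j"
    then have "n - j < n - i" by auto
    then have "B ^ (n - j) < B ^ (n - i)" using B by (intro power_strict_increasing) auto
    then show "M j < M i" using \<open>i < j\<close> by (simp add: M_def)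
  qed
  have "(\<Sum>i=1..n. mu i * (if i \<le> k then B ^ n else 0)) = (\<Sum>i=1..k. mu i * B ^ n)"
    using k by (intro sum.mono_neutral_cong_right) auto
  also have "\<dots> = B ^ n * (\<Sum>i=1..k. mu i)" by (simp only: sum_distrib_left mult.commute)
  finally show "pairing n M mu = B ^ n * (\<Sum>i=1..k. mu i) + (\<Sum>i=1..n. mu i * B ^ (n - i))"
    unfolding pairing_def M_def distrib_left sum.distrib by simp
qed

text \<open>
  For each \<open>k\<close>, the separating weights for a base exceeding all entries turn the bound on the exponents
  into the inequality between the \<open>k\<close>-th partial sums.
\<close>

lemma dominance_of_growth:
  assumes n: "n \<ge> 1" and fin: "finite P" and P: "P \<subseteq> partitions_upto n" and lam: "lam \<in> P"
    and lim: "\<And>M. decreasing_on {1..n} M \<Longrightarrow>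
      ((\<lambda>r. (\<Sum>mu\<in>P. d mu * monom_sym_BC n mu (curve M r)) * r ^ pairing n M lam) \<longlongrightarrow> v) (at 0)"
  shows "\<And>mu. mu \<in> P \<Longrightarrow> d mu \<noteq> 0 \<Longrightarrow> dominance_le n mu lam" and "d lam = v"
proof -
  \<comment> \<open>Any base that exceeds all entries would do; it must also be at least 2 for the weights to decrease.\<close>
  define B where "B = Suc (Suc (\<Sum>mu\<in>P. \<Sum>i=1..n. mu i))"
  have digit: "mu i < B" if "mu \<in> P" for mu i
  proof (cases "i \<in> {1..n}")
    case True
    have "mu i \<le> (\<Sum>i=1..n. mu i)" using True by (intro member_le_sum) auto
    also have "\<dots> \<le> (\<Sum>mu\<in>P. \<Sum>i=1..n. mu i)"
      using that fin by (intro member_le_sum[of mu P "\<lambda>mu. \<Sum>i=1..n. mu i"]) auto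
    finally show ?thesis by (simp add: B_def)
  next
    case False
    then have "mu i = 0" using that P unfolding partitions_upto_def by blast
    then show ?thesis by (simp add: B_def)
  qed
  have B: "2 \<le> B" by (simp add: B_def)
  define M where "M k i = (if i \<le> k then B ^ n else 0) + B ^ (n - i)" for k i
  let ?D = "\<lambda>mu. \<Sum>i=1..n. mu i * B ^ (n - i)"
  have dec: "decreasing_on {1..n} (M k)" if "k \<in> {1..n}" for k
    using separating_weights(1)[OF that B] unfolding M_def[abs_def] .
  have pair: "pairing n (M k) mu = B ^ n * (\<Sum>i=1..k. mu i) + ?D mu" if "k \<in> {1..n}" for k mu
    using separating_weights(2)[OF that B] unfolding M_def[abs_def] .
  have D: "?D mu < B ^ n" if "mu \<in> P" for mu
    by (rule digit_sum(1)) (intro allI digit[OF that])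
  have inj: "inj_on (pairing n (M k)) P" if k: "k \<in> {1..n}" for k
  proof (rule inj_onI)
    fix mu nu assume mu: "mu \<in> P" and nu: "nu \<in> P" and eq: "pairing n (M k) mu = pairing n (M k) nu"
    have "(B ^ n * (\<Sum>i=1..k. mu i) + ?D mu) mod B ^ n = ?D mu"
      "(B ^ n * (\<Sum>i=1..k. nu i) + ?D nu) mod B ^ n = ?D nu"
      using D[OF mu] D[OF nu] by simp_all
    then have D_eq: "?D mu = ?D nu" using eq unfolding pair[OF k] by metis
    have "mu i = nu i" if "i \<in> {1..n}" for i
    proof -
      have "\<forall>i. mu i < B" "\<forall>i. nu i < B" by (intro allI digit mu nu)+
      then show ?thesis by (intro bspec[OF digit_sum(2)[OF _ _ D_eq] that])
    qed
    moreover have "mu i = nu i" if "i \<notin> {1..n}" for i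
    proof -
      have "mu \<in> partitions_upto n" "nu \<in> partitions_upto n" using mu nu P by auto
      then show ?thesis using that unfolding partitions_upto_def by (simp del: atLeastAtMost_iff)
    qed
    ultimately have "mu i = nu i" for i by (cases "i \<in> {1..n}")
    then show "mu = nu" by (rule ext)
  qed
  have mlim: "((\<lambda>r. monom_sym_BC n mu (curve (M k) r) * r ^ pairing n (M k) mu) \<longlongrightarrow> 1) (at 0)"
    if "k \<in> {1..n}" "mu \<in> P" for k mu
    using monom_sym_BC_limit[OF _ dec[OF that(1)]] that(2) P by blast
  show "dominance_le n mu lam" if mu: "mu \<in> P" "d mu \<noteq> 0" for mu
    unfolding dominance_le_def
  proof
    fix k assume k: "k \<in> {1..n}"
    have "B ^ n * (\<Sum>i=1..k. mu i) \<le> pairing n (M k) mu" unfolding pair[OF k] by simp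
    also have "\<dots> \<le> pairing n (M k) lam" 
      by (rule leading_exponent(1)[where p = "pairing n (M k)" and d = d
            and m = "\<lambda>mu r. monom_sym_BC n mu (curve (M k) r)", OF fin inj[OF k] mlim[OF k] lim[OF dec[OF k]] mu])
    also have "\<dots> < B ^ n * Suc (\<Sum>i=1..k. lam i)" unfolding pair[OF k] using D[OF lam] by simp
    finally have "(\<Sum>i=1..k. mu i) < Suc (\<Sum>i=1..k. lam i)" by (simp only: nat_mult_less_cancel_disj)
    then show "(\<Sum>i=1..k. mu i) \<le> (\<Sum>i=1..k. lam i)" by simp
  qed
  have 1: "1 \<in> {1..n}" using n by simp
  have "(\<Sum>mu\<in>P. if pairing n (M 1) mu = pairing n (M 1) lam then d mu else 0) = v"
    by (rule leading_exponent(2)[where p = "pairing n (M 1)" and d = d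
          and m = "\<lambda>mu r. monom_sym_BC n mu (curve (M 1) r)", OF fin inj[OF 1] mlim[OF 1] lim[OF dec[OF 1]]])
  moreover have "(\<Sum>mu\<in>P. if pairing n (M 1) mu = pairing n (M 1) lam then d mu else 0) =
      (\<Sum>mu\<in>P. if mu = lam then d lam else 0)"
  proof (rule sum.cong[OF refl])
    fix mu assume "mu \<in> P"
    then have "pairing n (M 1) mu = pairing n (M 1) lam \<longleftrightarrow> mu = lam"
      using inj_on_eq_iff[OF inj[OF 1] _ lam] by blast
    then show "(if pairing n (M 1) mu = pairing n (M 1) lam then d mu else 0) = (if mu = lam then d lam else 0)"
      by simp
  qed
  ultimately show "d lam = v" using lam fin by simp
qed

context koornwinder
begin

text \<open>
  The limit identifies the coefficient of \<open>m\<^sub>\<lambda>\<close> and bounds all others. The partition \<open>\<lambda>\<close> is added to the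
  index set of the expansion with coefficient \<open>0\<close> if it does not occur there already.
\<close>

lemma peel_sum_expansion:
  assumes n: "n \<ge> 1" and lam: "lam \<in> partitions_upto n" and t: "t \<noteq> 1"
  shows "\<exists>d. \<forall>z\<in>generic_points n. peel_sum (map lam [1..<Suc n]) {1..n} z =
    K_norm n lam t a b t0 t1 t2 t3 * monom_sym_BC n lam z +
    (\<Sum>mu\<in>{mu \<in> partitions_upto n. dominance_less n mu lam}. d mu * monom_sym_BC n mu z)"
proof -
  let ?ls = "map lam [1..<Suc n]" and ?v = "K_norm n lam t a b t0 t1 t2 t3"
  let ?D = "{mu \<in> partitions_upto n. dominance_less n mu lam}"
  have len: "length ?ls = card {1..n}" by simp
  obtain f where f: "f \<in> symfun" "\<And>z. generic_on {1..n} z \<Longrightarrow> peel_sum ?ls {1..n} z = f (jouk z ` {1..n})"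
    using peel_sum_symfun[of ?ls] len by (metis finite_atLeastAtMost)
  obtain Q e where Q: "finite Q" "Q \<subseteq> partitions_upto n"
    "\<And>z. z \<in> generic_points n \<Longrightarrow> f (jouk z ` {1..n}) = (\<Sum>mu\<in>Q. e mu * monom_sym_BC n mu z)"
    using symfun_monom_expansion[OF f(1), of n] by blast
  define P where "P = insert lam Q"
  define d where "d mu = (if mu \<in> Q then e mu else 0)" for mu
  have P: "finite P" "P \<subseteq> partitions_upto n" "lam \<in> P" using Q lam by (auto simp: P_def)
  have expand: "peel_sum ?ls {1..n} z = (\<Sum>mu\<in>P. d mu * monom_sym_BC n mu z)"
    if z: "z \<in> generic_points n" for z
  proof -
    have "peel_sum ?ls {1..n} z = (\<Sum>mu\<in>Q. e mu * monom_sym_BC n mu z)"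
      using f(2) Q(3) z unfolding generic_points_iff by simp
    also have "\<dots> = (\<Sum>mu\<in>P. d mu * monom_sym_BC n mu z)"
      using P(1) by (intro sum.mono_neutral_cong_left) (auto simp: P_def d_def)
    finally show ?thesis .
  qed
  have sorted: "sorted_wrt (\<ge>) ?ls" by (rule partition_list_sorted[OF lam])
  have lim: "((\<lambda>r. (\<Sum>mu\<in>P. d mu * monom_sym_BC n mu (curve M r)) * r ^ pairing n M lam) \<longlongrightarrow> ?v) (at 0)"
    if M: "decreasing_on {1..n} M" for M
  proof -
    have "((\<lambda>r. peel_sum ?ls {1..n} (curve M r) * r ^ weight ?ls {1..n} M) \<longlongrightarrow> lead_coef ?ls) (at 0)"
      using len by (intro peel_sum_limit M sorted) auto
    then have "((\<lambda>r. peel_sum ?ls {1..n} (curve M r) * r ^ pairing n M lam) \<longlongrightarrow> ?v) (at 0)"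
      unfolding weight_map_upt pairing_def[symmetric] K_norm_eq_lead_coef[OF t lam] .
    moreover have "eventually (\<lambda>r::complex. norm r < 1) (at 0)"
      by (rule order_tendstoD(2)[where y = 0]) (auto intro!: tendsto_eq_intros)
    then have "eventually (\<lambda>r. peel_sum ?ls {1..n} (curve M r) * r ^ pairing n M lam =
        (\<Sum>mu\<in>P. d mu * monom_sym_BC n mu (curve M r)) * r ^ pairing n M lam) (at 0)"
      unfolding eventually_at_filter
    proof (rule eventually_mono, intro impI)
      fix r :: complex assume "r \<noteq> 0 \<longrightarrow> r \<in> UNIV \<longrightarrow> norm r < 1" and r: "r \<noteq> 0" "r \<in> UNIV"
      then have "norm r < 1" by blast
      then show "peel_sum ?ls {1..n} (curve M r) * r ^ pairing n M lam =
          (\<Sum>mu\<in>P. d mu * monom_sym_BC n mu (curve M r)) * r ^ pairing n M lam"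
        by (simp only: expand[OF curve_generic[OF M r(1)]])
    qed
    ultimately show ?thesis by (rule Lim_transform_eventually)
  qed
  have dom: "dominance_le n mu lam" if "mu \<in> P" "d mu \<noteq> 0" for mu
    by (rule dominance_of_growth(1)[OF n P lim that])
  have lead: "d lam = ?v"
    by (rule dominance_of_growth(2)[OF n P lim])
  have "peel_sum ?ls {1..n} z = ?v * monom_sym_BC n lam z + (\<Sum>mu\<in>?D. d mu * monom_sym_BC n mu z)"
    if z: "z \<in> generic_points n" for z
  proof -
    let ?m = "\<lambda>mu. d mu * monom_sym_BC n mu z"
    have "(\<Sum>mu\<in>P. ?m mu) = ?m lam + (\<Sum>mu\<in>P - {lam}. ?m mu)"
      using P by (simp add: sum.remove)
    also have "(\<Sum>mu\<in>P - {lam}. ?m mu) = (\<Sum>mu\<in>(P - {lam}) \<inter> ?D. ?m mu)"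
      using P dom by (intro sum.mono_neutral_right) (auto simp: dominance_less_def)
    also have "\<dots> = (\<Sum>mu\<in>?D. ?m mu)"
      using P by (intro sum.mono_neutral_left finite_dominated) (auto simp: P_def d_def dominance_less_def)
    finally show ?thesis by (simp only: expand[OF z] lead)
  qed
  then show ?thesis by blast
qed

end

theorem theorem2p6:
  fixes n :: nat and lam :: "nat \<Rightarrow> nat" and t a b t0 t1 t2 t3 :: complex
  assumes "n \<ge> 1"
    and "lam \<in> partitions_upto n"
    and "norm t < 1" and "norm a < 1" and "norm b < 1"
    and "norm t0 < 1" and "norm t1 < 1" and "norm t2 < 1" and "norm t3 < 1"
  shows "\<exists>c :: (nat \<Rightarrow> nat) \<Rightarrow> complex. \<forall>z \<in> generic_points n.
           K_poly n lam t a b t0 t1 t2 t3 z =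
             monom_sym_BC n lam z +
             (\<Sum>mu \<in> {mu \<in> partitions_upto n. dominance_less n mu lam}. c mu * monom_sym_BC n mu z)"
proof -
  interpret koornwinder t a b t0 t1 t2 t3 .
  let ?v = "K_norm n lam t a b t0 t1 t2 t3"
  let ?D = "{mu \<in> partitions_upto n. dominance_less n mu lam}"
  have v: "?v \<noteq> 0" using assms(3-9) by (rule K_norm_nonzero)
  have "t \<noteq> 1" using assms(3) by auto
  from peel_sum_expansion[OF assms(1,2) this] obtain d where d: "\<And>z. z \<in> generic_points n \<Longrightarrow>
      peel_sum (map lam [1..<Suc n]) {1..n} z =
      ?v * monom_sym_BC n lam z + (\<Sum>mu\<in>?D. d mu * monom_sym_BC n mu z)"
    by blast
  have "K_poly n lam t a b t0 t1 t2 t3 z =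
      monom_sym_BC n lam z + (\<Sum>mu\<in>?D. (d mu / ?v) * monom_sym_BC n mu z)"
    if z: "z \<in> generic_points n" for z
  proof -
    have "(\<Sum>mu\<in>?D. (d mu / ?v) * monom_sym_BC n mu z) = (\<Sum>mu\<in>?D. d mu * monom_sym_BC n mu z) / ?v"
      by (simp add: sum_divide_distrib)
    then show ?thesis
      unfolding K_poly_def hyperoctahedral_sum_eq_peel_sum d[OF z] using v by (simp add: add_divide_distrib)
  qed
  then show ?thesis by (intro exI[of _ "\<lambda>mu. d mu / ?v"] ballI)
qed

end
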